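(* Let $k \geq 2$ be an integer. There exists $n_0 = n_0(k)$ such that for every $n \geq n_0$, the unique graph (up to isomorphism) on $n$ vertices that contains no cycle $C_{2k+2}$ as a subgraph and has the maximum adjacency spectral radius among all such graphs is $S_{n,k}^+$. That is, $\mathrm{SPEX}(n, C_{2k+2}) = \{S_{n,k}^+\}$.
   Context: For a graph $G$, $\lambda(G)$ denotes the spectral radius (largest eigenvalue) of its adjacency matrix. For a family $\mathcal{F}$ of graphs, $\mathrm{spex}(n,\mathcal{F})$ is the maximum of $\lambda(G)$ over all $n$-vertex graphs $G$ containing no member of $\mathcal{F}$ as a (not necessarily induced) subgraph, and $\mathrm{SPEX}(n,\mathcal{F})$ is the set of such $n$-vertex graphs attaining this maximum. For $n>k$, $S_{n,k} := K_k \vee \overline{K}_{n-k}$ is the join of a clique on $k$ vertices with an independent set on $n-k$ vertices, and $S_{n,k}^+ := K_k \vee (\overline{K}_{n-k-2} \cup K_2)$ is the graph obtained from $S_{n,k}$ by adding one edge inside the independent set. *)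

theory Defs
  imports Complex_Main
begin

definition is_graph :: "nat \<Rightarrow> (nat \<Rightarrow> nat \<Rightarrow> bool) \<Rightarrow> bool" where
  "is_graph n E \<longleftrightarrow> (\<forall>i j. E i j \<longrightarrow> i < n \<and> j < n) \<and>
     (\<forall>i j. E i j \<longrightarrow> E j i) \<and> (\<forall>i. \<not> E i i)"

text \<open>Real eigenvalues of the adjacency matrix (all eigenvalues are real,
  the matrix being real symmetric).\<close>
definition adj_eigenvalues :: "nat \<Rightarrow> (nat \<Rightarrow> nat \<Rightarrow> bool) \<Rightarrow> real set" where
  "adj_eigenvalues n E = {\<mu>. \<exists>v :: nat \<Rightarrow> real.
      (\<forall>i\<ge>n. v i = 0) \<and> (\<exists>i<n. v i \<noteq> 0) \<and>
      (\<forall>i<n. (\<Sum>j<n. (if E i j then 1 else 0) * v j) = \<mu> * v i)}"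

definition spectral_radius :: "nat \<Rightarrow> (nat \<Rightarrow> nat \<Rightarrow> bool) \<Rightarrow> real" where
  "spectral_radius n E = Max (adj_eigenvalues n E)"

definition contains_cycle :: "nat \<Rightarrow> (nat \<Rightarrow> nat \<Rightarrow> bool) \<Rightarrow> nat \<Rightarrow> bool" where
  "contains_cycle n E m \<longleftrightarrow> (\<exists>vs. length vs = m \<and> distinct vs \<and> set vs \<subseteq> {0..<n} \<and>
      (\<forall>i<m. E (vs ! i) (vs ! ((i + 1) mod m))))"

definition spex :: "nat \<Rightarrow> nat \<Rightarrow> real" where
  "spex n m = Max {spectral_radius n E | E. is_graph n E \<and> \<not> contains_cycle n E m}"

definition SPEX :: "nat \<Rightarrow> nat \<Rightarrow> (nat \<Rightarrow> nat \<Rightarrow> bool) set" where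
  "SPEX n m = {E. is_graph n E \<and> \<not> contains_cycle n E m \<and> spectral_radius n E = spex n m}"

definition graph_iso :: "nat \<Rightarrow> (nat \<Rightarrow> nat \<Rightarrow> bool) \<Rightarrow> (nat \<Rightarrow> nat \<Rightarrow> bool) \<Rightarrow> bool" where
  "graph_iso n E F \<longleftrightarrow> (\<exists>f. bij_betw f {0..<n} {0..<n} \<and>
      (\<forall>i<n. \<forall>j<n. E i j \<longleftrightarrow> F (f i) (f j)))"

text \<open>S_{n,k}^+ = K_k join (independent set of size n-k-2 plus K_2):
  clique on {0..<k}, joined to all of {k..<n}, plus the edge {k, k+1}.\<close>
definition S_plus :: "nat \<Rightarrow> nat \<Rightarrow> nat \<Rightarrow> nat \<Rightarrow> bool" where
  "S_plus n k i j \<longleftrightarrow> i < n \<and> j < n \<and> i \<noteq> j \<and>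
      (i < k \<or> j < k \<or> {i, j} = {k, k + 1})"

end

theory Submission
  imports Defs "HOL-Analysis.Analysis"
begin

text \<open>Let \<open>x\<close> be a Perron vector, scaled to maximum 1, of a \<open>C\<^bsub>2k+2\<^esub>\<close>-free graph whose spectral
  radius \<open>l\<close> is at least that of \<open>S\<^sub>n\<^sub>,\<^sub>k\<^sup>+\<close>, so \<open>l\<^sup>2 \<ge> k(n - k)\<close>. Expanding \<open>l\<^sup>2 x\<^sub>v\<close> over walks of length two,
  and using that the edges leaving a neighbourhood are sparse, one sees in turn that few vertices
  have \<open>x\<^sub>v\<close> bounded below (there are \<open>o(n\<^bsup>3/2\<^esup>)\<close> edges in all), that these have linear degree,
  that there are boundedly many of them (as \<open>K\<^bsub>k+1,k+1\<^esub>\<close> contains \<open>C\<^bsub>2k+2\<^esub>\<close>), and finally that \<open>k\<close> of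
  them, with entries at least 1/2, have almost all vertices as common neighbours. Forbidding
  \<open>C\<^bsub>2k+2\<^esub>\<close> leaves at most one edge among the common neighbours \<open>R\<close>, and at most one neighbour in
  \<open>R\<close> for each of the few remaining vertices \<open>W\<close>. Evaluating the quadratic form of the candidate
  at \<open>x\<close>, every vertex of \<open>W\<close> misses an edge of weight at least \<open>x\<^sub>w/2\<close>, while the superfluous
  edges weigh less in total; hence \<open>x\<close> vanishes on \<open>W\<close>, and the equality case of the Rayleigh
  principle shows that the graph is the candidate.\<close>

section \<open>Cycles from dense bipartite cores\<close>

text \<open>Two obstacles shape the proof. A vertex with entry at least \<open>c\<close> has degree
  at least \<open>c * l\<close>, and \<open>l\<close> is only known to be of order n^(1/2) or more;
  so a bound o(n) on the number of such vertices requires o(n^(3/2)) edges. Growth of three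
  consecutive spheres yields an edge bound of order n^(4/3), and asks of dense pieces only that a
  path of prescribed length can be threaded through them greedily. The second obstacle is that
  \<open>W\<close> is only known to have at most \<open>d * n\<close> vertices for a small constant
  \<open>d\<close>, so its edges cannot be discarded by counting. Estimating an edge from
  \<open>W\<close> to \<open>R\<close> by \<open>x r \<le> 1\<close> could cost more than the
  missing edge gains. Two facts help: the eigenvalue equation makes entries on \<open>R\<close> of
  order 1/l, up to weight coming from \<open>W\<close> itself, and the two-walk bound inside
  \<open>W\<close> makes the quadratic form there a small multiple of \<open>l\<close> times the
  squared norm.\<close>

lemma contains_cycleI:
  assumes "is_graph n E" "length vs = m" "m \<ge> 2" "distinct vs"
    "successively E vs" "E (last vs) (hd vs)"
  shows "contains_cycle n E m"
proof -
  have nth: "E (vs ! i) (vs ! ((i + 1) mod m))" if "i < m" for i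
  proof (cases "Suc i < m")
    case True
    then show ?thesis
      using assms(2,5) by (auto simp: successively_conv_nth)
  next
    case False
    then have "i = m - 1" "Suc i = m" using that by auto
    moreover have "last vs = vs ! (m - 1)" "hd vs = vs ! 0"
      using assms(2,3) by (cases "vs = []"; simp add: last_conv_nth hd_conv_nth)+
    ultimately show ?thesis using assms(6) by simp
  qed
  moreover have "vs ! i < n" if "i < m" for i
    using nth[OF that] assms(1) by (simp add: is_graph_def)
  then have "set vs \<subseteq> {0..<n}" using assms(2) by (auto simp: in_set_conv_nth)
  ultimately show ?thesis
    using assms(2,4) unfolding contains_cycle_def by blast
qed

section \<open>Dense cores and greedy paths\<close>

definition epairs :: "('a \<Rightarrow> 'b \<Rightarrow> bool) \<Rightarrow> 'a set \<Rightarrow> 'b set \<Rightarrow> nat" where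
  "epairs P A B = card {(a, b). a \<in> A \<and> b \<in> B \<and> P a b}"

lemma epairs_eq_sum:
  assumes "finite A" "finite B"
  shows "epairs P A B = (\<Sum>a\<in>A. card {b\<in>B. P a b})"
proof -
  have "{(a, b). a \<in> A \<and> b \<in> B \<and> P a b} = (SIGMA a:A. {b\<in>B. P a b})" by auto
  then show ?thesis unfolding epairs_def using assms by (simp add: card_SigmaI)
qed

lemma epairs_commute: "epairs P A B = epairs (\<lambda>b a. P a b) B A"
proof -
  have "bij_betw prod.swap {(a, b). a \<in> A \<and> b \<in> B \<and> P a b}
     {(b, a). b \<in> B \<and> a \<in> A \<and> P a b}"
    by (intro bij_betwI[where g = prod.swap]) auto
  then show ?thesis unfolding epairs_def by (rule bij_betw_same_card)
qed

lemma epairs_eq_sum_right: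
  assumes "finite A" "finite B"
  shows "epairs P A B = (\<Sum>b\<in>B. card {a\<in>A. P a b})"
  unfolding epairs_commute[of P A B] by (rule epairs_eq_sum[OF assms(2,1)])

lemma epairs_sym:
  assumes "\<And>a b. P a b \<longleftrightarrow> P b a"
  shows "epairs P A B = epairs P B A"
proof -
  have "(\<lambda>b a. P a b) = P" by (intro ext) (rule assms)
  then show ?thesis using epairs_commute[of P A B] by metis
qed

lemma epairs_Un_right:
  assumes "finite A" "finite B" "finite C" "B \<inter> C = {}"
  shows "epairs P A (B \<union> C) = epairs P A B + epairs P A C"
proof -
  have "card {b \<in> B \<union> C. P a b} = card {b \<in> B. P a b} + card {b \<in> C. P a b}" for a
  proof -
    have "{b \<in> B \<union> C. P a b} = {b \<in> B. P a b} \<union> {b \<in> C. P a b}" by auto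
    moreover have "card ({b \<in> B. P a b} \<union> {b \<in> C. P a b}) = card {b \<in> B. P a b} + card {b \<in> C. P a b}"
      by (rule card_Un_disjoint) (use assms in auto)
    ultimately show ?thesis by simp
  qed
  then show ?thesis using assms by (simp add: epairs_eq_sum sum.distrib)
qed

text \<open>The two sides of a core may overlap, so that one notion covers edges inside a set as well as
  edges between two sets; the greedy paths below avoid repeated vertices in either case.\<close>

definition bicore :: "nat \<Rightarrow> ('a \<Rightarrow> 'b \<Rightarrow> bool) \<Rightarrow> 'a set \<Rightarrow> 'b set \<Rightarrow> bool" where
  "bicore K P A B \<longleftrightarrow> A \<noteq> {} \<and>
     (\<forall>a\<in>A. card {b\<in>B. P a b} > K) \<and> (\<forall>b\<in>B. card {a\<in>A. P a b} > K)"

text \<open>Delete a vertex with at most \<open>K\<close> partners on the other side as long as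
  there is one. A deletion lowers the left side of the inequality by at most \<open>K\<close> and
  the right side by exactly \<open>K\<close>, so the strict inequality survives and neither side
  becomes empty. An element common to \<open>A\<close> and \<open>B\<close> is deleted from one side
  at a time.\<close>

lemma dense_core_exists:
  fixes P :: "'a \<Rightarrow> 'b \<Rightarrow> bool"
  assumes "finite A" "finite B" "epairs P A B > K * (card A + card B)"
  shows "\<exists>A' B'. A' \<subseteq> A \<and> B' \<subseteq> B \<and> bicore K P A' B'"
  using assms
proof (induction "card A + card B" arbitrary: A B rule: less_induct)
  case less
  note fin = less.prems(1,2)
  show ?case
  proof (cases "\<exists>a\<in>A. card {b\<in>B. P a b} \<le> K")
    case True
    then obtain a where a: "a \<in> A" "card {b\<in>B. P a b} \<le> K" by blast
    have c: "card A = Suc (card (A - {a}))"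
      using a fin card_Suc_Diff1[of A a] by simp
    have "epairs P A B = card {b\<in>B. P a b} + epairs P (A - {a}) B"
      using a fin sum.remove[of A a "\<lambda>a. card {b\<in>B. P a b}"] by (simp add: epairs_eq_sum)
    moreover have "K * (card A + card B) = K + K * (card (A - {a}) + card B)" using c by simp
    ultimately have "epairs P (A - {a}) B > K * (card (A - {a}) + card B)"
      using a(2) less.prems(3) by linarith
    then have "\<exists>A' B'. A' \<subseteq> A - {a} \<and> B' \<subseteq> B \<and> bicore K P A' B'"
      using c fin by (intro less.hyps) auto
    then show ?thesis by blast
  next
    case noA: False
    show ?thesis
    proof (cases "\<exists>b\<in>B. card {a\<in>A. P a b} \<le> K")
      case True
      then obtain b where b: "b \<in> B" "card {a\<in>A. P a b} \<le> K" by blast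
      have c: "card B = Suc (card (B - {b}))"
        using b fin card_Suc_Diff1[of B b] by simp
      have "epairs P A B = card {a\<in>A. P a b} + epairs P A (B - {b})"
        using b fin sum.remove[of B b "\<lambda>b. card {a\<in>A. P a b}"] by (simp add: epairs_eq_sum_right)
      moreover have "K * (card A + card B) = K + K * (card A + card (B - {b}))" using c by simp
      ultimately have "epairs P A (B - {b}) > K * (card A + card (B - {b}))"
        using b(2) less.prems(3) by linarith
      then have "\<exists>A' B'. A' \<subseteq> A \<and> B' \<subseteq> B - {b} \<and> bicore K P A' B'"
        using c fin by (intro less.hyps) auto
      then show ?thesis by blast
    next
      case False
      have "epairs P A B > 0" using less.prems(3) by simp
      then have "A \<noteq> {}" "B \<noteq> {}" by (auto simp: epairs_def)
      then show ?thesis using noA False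
        by (intro exI[of _ A] exI[of _ B]) (auto simp: not_le bicore_def)
    qed
  qed
qed

lemma dense_core:
  fixes P :: "'a \<Rightarrow> 'b \<Rightarrow> bool"
  assumes "finite A" "finite B" "\<not> epairs P A B \<le> K * (card A + card B)"
  obtains A' B' where "A' \<subseteq> A" "B' \<subseteq> B" "bicore K P A' B'"
  using dense_core_exists[of A B K P] assms by auto

text \<open>The path is greedy: each vertex has more than \<open>K\<close> neighbours on the other
  side, of which at most \<open>K\<close> are forbidden or already used. In the induction the used
  vertices join \<open>F\<close> and the two sides swap roles.\<close>

lemma alt_path:
  fixes E :: "'a \<Rightarrow> 'a \<Rightarrow> bool"
  assumes "\<And>a. a \<in> A \<Longrightarrow> card {b\<in>B. E a b} > K" "\<And>b. b \<in> B \<Longrightarrow> card {a\<in>A. E b a} > K"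
    "finite F" "card F + m \<le> K" "x \<in> A" "x \<notin> F"
  shows "\<exists>p. length p = Suc m \<and> hd p = x \<and> distinct p \<and> set p \<inter> F = {} \<and> successively E p \<and>
     set p \<subseteq> A \<union> B \<and> last p \<in> (if even m then A else B)"
  using assms
proof (induction m arbitrary: A B F x)
  case 0
  then show ?case by (intro exI[of _ "[x]"]) auto
next
  case (Suc m)
  have "card (insert x F) \<le> K" using Suc.prems by (simp add: card_insert_if)
  then have "card (insert x F) < card {b\<in>B. E x b}" using Suc.prems(1)[of x] Suc.prems(5) by simp
  then have "\<not> {b\<in>B. E x b} \<subseteq> insert x F"
    using Suc.prems(3) by (meson card_mono finite_insert leD)
  then obtain y where y: "y \<in> B" "E x y" "y \<notin> insert x F" by blast
  have "card (insert x F) + m \<le> K" using Suc.prems(3,4,6) by simp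
  then obtain p where p: "length p = Suc m" "hd p = y" "distinct p" "set p \<inter> insert x F = {}"
     "successively E p" "set p \<subseteq> B \<union> A" "last p \<in> (if even m then B else A)"
    using Suc.IH[of B A "insert x F" y] Suc.prems(1,2,3) y by auto
  have "p \<noteq> []" using p(1) by auto
  then show ?case using p y Suc.prems(5,6)
    by (intro exI[of _ "x # p"]) (auto simp: successively_Cons split: if_splits)
qed

section \<open>Sparse spheres and the edge bound in a graph without the forbidden cycle\<close>

locale cycle_free =
  fixes n k :: nat and E :: "nat \<Rightarrow> nat \<Rightarrow> bool"
  assumes graph: "is_graph n E"
    and free: "\<not> contains_cycle n E (2 * k + 2)"
    and k2: "2 \<le> k"
begin

definition N :: "nat \<Rightarrow> nat set" where "N v = {u. E v u}"

lemma E_sym: "E u v \<longleftrightarrow> E v u" using graph by (auto simp: is_graph_def)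
lemma E_irrefl [simp]: "\<not> E v v" using graph by (auto simp: is_graph_def)
lemma E_lt: "E u v \<Longrightarrow> u < n \<and> v < n" using graph by (auto simp: is_graph_def)
lemma N_subset: "N v \<subseteq> {..<n}" using E_lt by (auto simp: N_def)
lemma finite_N [simp]: "finite (N v)" using N_subset finite_subset by blast
lemma in_N [simp]: "u \<in> N v \<longleftrightarrow> E v u" by (simp add: N_def)
lemma epairs_E_sym: "epairs E A B = epairs E B A" by (rule epairs_sym) (rule E_sym)

lemma no_cycle:
  assumes "length vs = 2 * k + 2" "distinct vs" "successively E vs" "E (last vs) (hd vs)"
  shows False
  using contains_cycleI[OF graph assms(1) _ assms(2-4)] free by simp

text \<open>The core carries a path on \<open>2 * k + 1\<close> vertices with both ends in
  \<open>A\<close>; it misses \<open>v\<close>, so it closes through \<open>v\<close> to a forbidden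
  cycle.\<close>

lemma no_core_in_N:
  assumes "A \<subseteq> N v" "v \<notin> B" "bicore (2 * k + 2) E A B"
  shows False
proof -
  have deg: "\<And>a. a \<in> A \<Longrightarrow> card {b\<in>B. E a b} > 2 * k + 2" "\<And>b. b \<in> B \<Longrightarrow> card {a\<in>A. E b a} > 2 * k + 2"
    using assms(3) E_sym by (simp_all add: bicore_def)
  obtain x where x: "x \<in> A" using assms(3) by (auto simp: bicore_def)
  obtain p where p: "length p = Suc (2 * k)" "hd p = x" "distinct p" "successively E p"
     "set p \<subseteq> A \<union> B" "last p \<in> A"
    using alt_path[where A = A and B = B and E = E and K = "2 * k + 2" and F = "{}" and m = "2 * k" and x = x] deg x by auto
  have "v \<notin> set p" using p(5) assms(1,2) by auto
  moreover have "p \<noteq> []" using p(1) by auto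
  moreover have "E v x" "E (last p) v" using x p(6) assms(1) E_sym by auto
  ultimately show False
    using no_cycle[of "v # p"] p by (auto simp: successively_Cons)
qed

lemma epairs_N:
  assumes "A \<subseteq> N v" "B \<subseteq> {..<n}" "v \<notin> B"
  shows "epairs E A B \<le> (2 * k + 2) * (card A + card B)"
proof (rule ccontr)
  assume dense: "\<not> ?thesis"
  have fin: "finite A" "finite B" using assms(1,2) by (auto intro: finite_subset[OF _ finite_N] finite_subset[OF _ finite_lessThan])
  obtain A' B' where "A' \<subseteq> A" "B' \<subseteq> B" "bicore (2 * k + 2) E A' B'"
    by (rule dense_core[OF fin dense])
  then show False
    using no_core_in_N[of A' v B'] assms by blast
qed

text \<open>Two vertices of the second sphere with different parents close a path of length
  \<open>2k - 2\<close> through \<^term>\<open>v\<close>; if all parents agree, a path of length \<open>2k\<close> is closed through the parent.\<close>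

lemma epairs_second_level:
  assumes "\<And>a. a \<in> A \<Longrightarrow> \<exists>u. E v u \<and> E u a" "A \<inter> insert v (N v) = {}"
    "B \<subseteq> {..<n}" "B \<inter> insert v (N v) = {}"
  shows "epairs E A B \<le> (2 * k + 2) * (card A + card B)"
proof (rule ccontr)
  assume dense: "\<not> ?thesis"
  have "A \<subseteq> {..<n}" using assms(1) E_lt by auto
  then have finA: "finite A" using finite_subset by blast
  have finB: "finite B" using assms finite_subset by blast
  obtain A' B' where AB: "A' \<subseteq> A" "B' \<subseteq> B" "bicore (2 * k + 2) E A' B'"
    by (rule dense_core[OF finA finB dense])
  have AB5: "\<And>a. a\<in>A' \<Longrightarrow> card {b\<in>B'. E a b} > 2 * k + 2" "\<And>b. b\<in>B' \<Longrightarrow> card {a\<in>A'. E b a} > 2 * k + 2"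
    using AB(3) E_sym by (simp_all add: bicore_def)
  have "\<forall>a\<in>A'. \<exists>u. E v u \<and> E u a" using assms(1) AB(1) by blast
  then obtain f where f: "\<And>a. a \<in> A' \<Longrightarrow> E v (f a) \<and> E (f a) a" by metis
  show False
  proof (cases "\<exists>b\<in>B'. \<exists>a1\<in>A'. \<exists>a2\<in>A'. E b a1 \<and> E b a2 \<and> f a1 \<noteq> f a2")
    case True
    then obtain b a1 a2 where b: "b \<in> B'" "a1 \<in> A'" "a2 \<in> A'" "E b a1" "E b a2" "f a1 \<noteq> f a2"
      by blast
    have "card {a1, a2} \<le> 2" by (simp add: card_insert_if)
    then have F: "card {a1, a2} + (2 * k - 3) \<le> 2 * k + 2" by linarith
    have bF: "b \<notin> {a1, a2}" using b by auto
    have odd: "\<not> even (2 * k - 3)" using k2 by simp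
    obtain q where q: "length q = Suc (2 * k - 3)" "hd q = b" "distinct q"
      "set q \<inter> {a1, a2} = {}" "successively E q" "set q \<subseteq> B' \<union> A'" "last q \<in> A'"
      using alt_path[where A = B' and B = A' and E = E and K = "2 * k + 2" and F = "{a1, a2}" and m = "2 * k - 3" and x = b,
          OF AB5(2,1) _ F b(1) bF] odd by auto
    have ne: "q \<noteq> []" using q(1) by auto
    have len: "length q = 2 * k - 2" using q(1) k2 by simp
    \<comment> \<open>The parent of \<open>last q\<close> differs from that of \<open>a1\<close> or
      of \<open>a2\<close>. For such an \<open>a\<close> the cycle is \<open>v\<close>,
      \<open>f a\<close>, \<open>a\<close>, then \<open>q\<close> from \<open>b\<close> to
      \<open>last q\<close>, then \<open>f (last q)\<close>: in all 3 + (2k - 2) + 1 vertices. The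
      odd number of steps in \<open>q\<close> is what makes it end in \<open>A'\<close>.\<close>
    have False if a: "a \<in> {a1, a2}" "f a \<noteq> f (last q)" for a
    proof -
      have aA: "a \<in> A'" "E b a" using a b by auto
      have "set q \<inter> insert v (N v) = {}" using q(6) AB(1,2) assms(2,4) by blast
      then have nq: "v \<notin> set q" "\<And>w. E v w \<Longrightarrow> w \<notin> set q" by (auto simp: disjoint_iff)
      have "a \<notin> insert v (N v)" using aA AB(1) assms(2) by blast
      then have na: "v \<noteq> a" "\<And>w. E v w \<Longrightarrow> w \<noteq> a" by auto
      have fz: "E v (f (last q))" "E (f (last q)) (last q)" using f q(7) by auto
      have fa: "E v (f a)" "E (f a) a" using f aA by auto
      have "successively E (v # f a # a # q @ [f (last q)])"
        using fa fz q ne aA(2) E_sym by (auto simp: successively_Cons successively_append_iff)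
      moreover have "distinct (v # f a # a # q @ [f (last q)])"
        using fa fz nq na q(3,4) a by auto
      moreover have "length (v # f a # a # q @ [f (last q)]) = 2 * k + 2"
        using len k2 by simp
      ultimately show False using no_cycle[of "v # f a # a # q @ [f (last q)]"] fz E_sym by auto
    qed
    then show False using b(6) by (metis insertCI)
  next
    case False
    obtain x where x: "x \<in> A'" using AB(3) by (auto simp: bicore_def)
    \<comment> \<open>In this case all neighbours in \<open>A'\<close> of a vertex of
      \<open>B'\<close> have one parent. Hence the fibre of \<open>f\<close> over
      \<open>f x\<close>, together with its neighbours, loses no degree: it is again a core, now
      inside the neighbourhood of \<open>f x\<close>.\<close>
    define A'' where "A'' = {a\<in>A'. f a = f x}"
    define B'' where "B'' = {b\<in>B'. \<exists>a\<in>A''. E b a}"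
    have "{b\<in>B''. E a b} = {b\<in>B'. E a b}" if "a \<in> A''" for a
      using that E_sym[of a] by (auto simp: B''_def)
    then have 1: "card {b\<in>B''. E a b} > 2 * k + 2" if "a \<in> A''" for a
      using that AB5(1)[of a] by (simp add: A''_def)
    have "{a\<in>A''. E a b} = {a\<in>A'. E a b}" if "b \<in> B''" for b
    proof -
      from that obtain a where "b \<in> B'" "a \<in> A'" "f a = f x" "E b a" by (auto simp: B''_def A''_def)
      then have "f a' = f x" if "a' \<in> A'" "E a' b" for a' using False that E_sym by metis
      then show ?thesis by (auto simp: A''_def)
    qed
    then have 2: "card {a\<in>A''. E a b} > 2 * k + 2" if "b \<in> B''" for b
      using that AB(3) by (simp add: B''_def bicore_def)
    have "E (f x) a" if "a \<in> A''" for a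
      using f[of a] that by (simp add: A''_def)
    then have "A'' \<subseteq> N (f x)" by auto
    moreover have "f x \<notin> B''" using f[OF x] AB(2) assms(4) by (auto simp: B''_def)
    moreover have "bicore (2 * k + 2) E A'' B''"
      unfolding bicore_def using x 1 2 by (auto simp: A''_def)
    ultimately show False by (rule no_core_in_N)
  qed
qed

lemma two_walks_le:
  assumes "W \<subseteq> {..<n}" "v \<notin> W"
  shows "(\<Sum>u\<in>N v. card (N u \<inter> W)) \<le> (2 * k + 2) * (card (N v) + card W)"
proof -
  have "epairs E (N v) W = (\<Sum>u\<in>N v. card (N u \<inter> W))"
    using assms finite_subset[of W] finite_N by (subst epairs_eq_sum) (auto simp: Int_def conj_commute)
  then show ?thesis using epairs_N[of "N v" v W] assms by simp
qed

text \<open>Consecutive spheres around a vertex grow by a factor of order \<^term>\<open>D\<close>,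
  and there is room for three of them.\<close>
lemma min_degree_bound:
  assumes D: "\<And>u w. E u w \<Longrightarrow> D \<le> card (N u)" and e: "E v v'" and big: "8 * (2 * k + 2) \<le> D"
  shows "D ^ 3 \<le> 8 * (2 * k + 2)^2 * n"
proof -
  define K where "K = 2 * k + 2"
  define A where "A = N v"
  define B where "B = (\<Union>u\<in>A. N u) - insert v A"
  \<comment> \<open>\<open>R\<close> contains \<open>B\<close>, so a single estimate covers the
    edges inside \<open>B\<close> and those leading further out.\<close>
  define R where "R = {..<n} - insert v A"
  have finA: "finite A" by (simp add: A_def)
  have Bn: "B \<subseteq> {..<n}" using N_subset by (auto simp: B_def)
  then have finB: "finite B" using finite_subset by blast
  have An: "A \<subseteq> {..<n}" using N_subset by (simp add: A_def)
  have vA: "v \<notin> A" by (simp add: A_def)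
  have vB: "v \<notin> B" by (simp add: B_def)
  have AB: "A \<inter> B = {}" by (auto simp: B_def)
  have BS: "\<And>a. a \<in> B \<Longrightarrow> \<exists>u. E v u \<and> E u a" by (auto simp: B_def A_def)
  have cA: "D \<le> card A" using D[OF e] by (simp add: A_def)
  have "D * card A = (\<Sum>a\<in>A. D)" by simp
  also have "\<dots> \<le> (\<Sum>a\<in>A. card (N a))"
    using D E_sym by (intro sum_mono) (auto simp: A_def)
  also have "\<dots> = epairs E A ({v} \<union> A \<union> B)"
  proof -
    have "{b \<in> {v} \<union> A \<union> B. E a b} = N a" if "a \<in> A" for a
      using that by (auto simp: B_def)
    then show ?thesis using finA finB by (simp add: epairs_eq_sum)
  qed
  also have "\<dots> = epairs E A {v} + epairs E A A + epairs E A B"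
    using finA finB vA vB AB epairs_Un_right[of A "{v} \<union> A" B E] epairs_Un_right[of A "{v}" A E]
    by (simp add: Int_Un_distrib2)
  also have "epairs E A {v} \<le> card A"
  proof -
    have "epairs E A {v} \<le> (\<Sum>a\<in>A. 1)"
      unfolding epairs_eq_sum[OF finA finite.insertI[OF finite.emptyI]]
      by (intro sum_mono) (auto intro: order_trans[OF card_mono[of "{v}"]])
    then show ?thesis by simp
  qed
  also have "epairs E A A \<le> K * (card A + card A)"
    unfolding K_def using An vA by (intro epairs_N[of A v]) (auto simp: A_def)
  also have "epairs E A B \<le> K * (card A + card B)"
    unfolding K_def using Bn vB by (intro epairs_N[of A v]) (auto simp: A_def)
  finally have 1: "D * card A \<le> card A + K * (card A + card A) + K * (card A + card B)" by simp
  have "D * card B = (\<Sum>b\<in>B. D)" by simp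
  also have "\<dots> \<le> (\<Sum>b\<in>B. card (N b))"
    using D E_sym BS by (intro sum_mono) blast
  also have "\<dots> = epairs E B (A \<union> R)"
  proof -
    have "{a \<in> A \<union> R. E b a} = N b" if "b \<in> B" for b
      using that N_subset[of b] E_sym by (auto simp: B_def R_def A_def)
    then show ?thesis using finA finB by (simp add: epairs_eq_sum R_def)
  qed
  also have "\<dots> = epairs E B A + epairs E B R"
    using finA finB by (subst epairs_Un_right) (auto simp: R_def)
  also have "epairs E B A = epairs E A B" by (rule epairs_E_sym)
  also have "epairs E A B \<le> K * (card A + card B)"
    unfolding K_def using Bn vB by (intro epairs_N[of A v]) (auto simp: A_def)
  also have "epairs E B R \<le> K * (card B + card R)"
    unfolding K_def using BS by (intro epairs_second_level[of B v]) (auto simp: R_def B_def A_def)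
  also have "card R \<le> n"
    using card_mono[of "{..<n}" R] by (auto simp: R_def)
  finally have 2: "D * card B \<le> K * (card A + card B) + K * (card B + n)" by simp
  have K: "8 * K \<le> D" "1 \<le> K" using big by (auto simp: K_def)
  then have KA: "8 * (K * card A) \<le> D * card A" "card A \<le> K * card A"
      "8 * (K * card B) \<le> D * card B"
    by (metis mult.assoc mult_le_mono1, simp, metis mult.assoc mult_le_mono1)
  \<comment> \<open>Because \<open>8 * K \<le> D\<close>, the \<open>card A\<close> terms on the
    right of \<open>1\<close> are absorbed on the left, and likewise the \<open>card B\<close> terms
    of \<open>2\<close>. What remains is growth by a factor of order D/K from \<open>A\<close> to
    \<open>B\<close>, and from \<open>B\<close> to \<open>n\<close>.\<close>
  have 3: "D * card A \<le> 2 * (K * card B)"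
    using 1 KA unfolding add_mult_distrib2 by linarith
  have 4: "D * card B \<le> 4 * (K * n)"
    using 2 3 KA unfolding add_mult_distrib2 by linarith
  have "D ^ 3 = D * D * D" by (simp add: power3_eq_cube)
  also have "\<dots> \<le> D * D * card A" using cA by simp
  also have "\<dots> \<le> D * (2 * (K * card B))" using 3 by (simp add: mult.assoc)
  also have "\<dots> = 2 * K * (D * card B)" by simp
  also have "\<dots> \<le> 2 * K * (4 * (K * n))" using 4 by (intro mult_le_mono2) auto
  finally show ?thesis by (simp add: K_def power2_eq_square algebra_simps)
qed

text \<open>Only edges are removed: vertices outside \<open>U\<close> stay as isolated vertices.
  This is why \<open>min_degree_bound\<close> asks for a large degree only at endpoints of
  edges.\<close>

lemma restrict_cycle_free: "cycle_free n k (\<lambda>i j. E i j \<and> i \<in> U \<and> j \<in> U)"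
proof
  show "is_graph n (\<lambda>i j. E i j \<and> i \<in> U \<and> j \<in> U)"
    using graph by (auto simp: is_graph_def)
  show "\<not> contains_cycle n (\<lambda>i j. E i j \<and> i \<in> U \<and> j \<in> U) (2 * k + 2)"
    using free unfolding contains_cycle_def by blast
qed (rule k2)

text \<open>Too many ordered adjacent pairs would give a core of degree above \<open>D\<close> with
  both sides taken from all vertices. The graph induced on the union of the two sides then
  contradicts \<open>min_degree_bound\<close>. Admissible \<open>D\<close> start at order
  n^(1/3).\<close>

lemma edge_bound:
  assumes "8 * (2 * k + 2) \<le> D" "D ^ 3 > 8 * (2 * k + 2)^2 * n"
  shows "epairs E {..<n} {..<n} \<le> 2 * D * n"
proof (rule ccontr)
  assume "\<not> ?thesis"
  then have dense: "\<not> epairs E {..<n} {..<n} \<le> D * (card {..<n} + card {..<n})" by (simp add: algebra_simps)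
  obtain A B where AB: "A \<subseteq> {..<n}" "B \<subseteq> {..<n}" "bicore D E A B"
    by (rule dense_core[OF finite_lessThan finite_lessThan dense])
  have AB5: "\<And>a. a \<in> A \<Longrightarrow> card {b\<in>B. E a b} > D" "\<And>b. b \<in> B \<Longrightarrow> card {a\<in>A. E a b} > D"
    using AB(3) by (simp_all add: bicore_def)
  define U where "U = A \<union> B"
  interpret H: cycle_free n k "\<lambda>i j. E i j \<and> i \<in> U \<and> j \<in> U" by (rule restrict_cycle_free)
  have U: "A \<subseteq> U" "B \<subseteq> U" by (auto simp: U_def)
  have deg: "D \<le> card (H.N u)" if u: "u \<in> U" for u
  proof (cases "u \<in> A")
    case True
    then have "D \<le> card {b\<in>B. E u b}" using AB5(1) by fastforce
    also have "\<dots> \<le> card (H.N u)" using u U by (intro card_mono H.finite_N) (auto simp: H.in_N)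
    finally show ?thesis .
  next
    case False
    then have "D \<le> card {a\<in>A. E a u}" using u AB5(2) by (fastforce simp: U_def)
    also have "\<dots> \<le> card (H.N u)" using u U E_sym by (intro card_mono H.finite_N) (auto simp: H.in_N)
    finally show ?thesis .
  qed
  obtain a where a: "a \<in> A" using AB(3) by (auto simp: bicore_def)
  then have "card {b\<in>B. E a b} \<noteq> 0" using AB5(1) by fastforce
  then obtain b where "b \<in> B" "E a b" by (metis (mono_tags, lifting) Collect_empty_eq card.empty)
  then have "E a b \<and> a \<in> U \<and> b \<in> U" using a by (simp add: U_def)
  then show False using H.min_degree_bound[of D a b] deg assms by fastforce
qed

end

section \<open>The Rayleigh quotient of a graph\<close>

definition adj_mult :: "nat \<Rightarrow> (nat \<Rightarrow> nat \<Rightarrow> bool) \<Rightarrow> (nat \<Rightarrow> real) \<Rightarrow> nat \<Rightarrow> real" where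
  "adj_mult n E x i = (\<Sum>j<n. (if E i j then 1 else 0) * x j)"

definition quad :: "nat \<Rightarrow> (nat \<Rightarrow> nat \<Rightarrow> bool) \<Rightarrow> (nat \<Rightarrow> real) \<Rightarrow> real" where
  "quad n E x = (\<Sum>i<n. x i * adj_mult n E x i)"

definition sqnorm :: "nat \<Rightarrow> (nat \<Rightarrow> real) \<Rightarrow> real" where
  "sqnorm n x = (\<Sum>i<n. (x i)\<^sup>2)"

lemma sqnorm_nonneg [simp]: "0 \<le> sqnorm n x"
  by (simp add: sqnorm_def sum_nonneg)

lemma sqnorm_pos: "i < n \<Longrightarrow> x i \<noteq> 0 \<Longrightarrow> 0 < sqnorm n x"
  unfolding sqnorm_def by (rule sum_pos2[of _ i]) auto

lemma adj_mult_eq_sum: "adj_mult n E x i = (\<Sum>j | j < n \<and> E i j. x j)"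
proof -
  have "adj_mult n E x i = (\<Sum>j\<in>{..<n}. if E i j then x j else 0)"
    unfolding adj_mult_def by (intro sum.cong) auto
  also have "\<dots> = (\<Sum>j | j \<in> {..<n} \<and> E i j. x j)" by (rule sum.inter_filter[symmetric]) simp
  finally show ?thesis by simp
qed

lemma quad_scale: "quad n E (\<lambda>i. c * x i) = c\<^sup>2 * quad n E x"
  unfolding quad_def adj_mult_def
  by (simp add: sum_distrib_left power2_eq_square algebra_simps)

lemma sqnorm_scale: "sqnorm n (\<lambda>i. c * x i) = c\<^sup>2 * sqnorm n x"
  by (simp add: sqnorm_def sum_distrib_left power_mult_distrib)

lemma adj_mult_inner_sym:
  assumes "is_graph n E"
  shows "(\<Sum>i<n. x i * adj_mult n E y i) = (\<Sum>i<n. y i * adj_mult n E x i)"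
proof -
  have "(\<Sum>i<n. x i * adj_mult n E y i) = (\<Sum>i<n. \<Sum>j<n. x i * ((if E i j then 1 else 0) * y j))"
    by (simp add: adj_mult_def sum_distrib_left)
  also have "\<dots> = (\<Sum>j<n. \<Sum>i<n. x i * ((if E i j then 1 else 0) * y j))" by (rule sum.swap)
  also have "\<dots> = (\<Sum>j<n. \<Sum>i<n. y j * ((if E j i then 1 else 0) * x i))"
    using assms by (intro sum.cong) (auto simp: is_graph_def)
  finally show ?thesis by (simp add: adj_mult_def sum_distrib_left)
qed

text \<open>The form has no \<open>t\<^sup>2\<close> term because the adjacency matrix has zero
  diagonal. So the derivative in a coordinate direction can be compared exactly with that of the
  norm.\<close>

lemma quad_perturb:
  assumes "is_graph n E" "i < n"
  shows "quad n E (\<lambda>j. x j + t * (if j = i then 1 else 0)) = quad n E x + 2 * t * adj_mult n E x i"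
    and "sqnorm n (\<lambda>j. x j + t * (if j = i then 1 else 0)) = sqnorm n x + 2 * t * x i + t\<^sup>2"
proof -
  let ?e = "\<lambda>j. if j = i then 1 else 0 :: real"
  have lin: "adj_mult n E (\<lambda>j. x j + t * ?e j) l = adj_mult n E x l + t * adj_mult n E ?e l" for l
    unfolding adj_mult_def by (simp add: algebra_simps sum.distrib sum_distrib_left)
  have delta: "(\<Sum>j<n. ?e j * f j) = f i" for f :: "nat \<Rightarrow> real"
    using assms(2) by (simp add: if_distrib[of "\<lambda>c. c * _"] sum.delta cong: if_cong)
  have "adj_mult n E ?e i = 0"
    using assms(1) by (auto simp: adj_mult_def is_graph_def intro!: sum.neutral)
  moreover have "(\<Sum>j<n. x j * adj_mult n E ?e j) = adj_mult n E x i"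
    using adj_mult_inner_sym[OF assms(1), of x ?e] by (simp only: delta)
  moreover have "quad n E (\<lambda>j. x j + t * ?e j) = quad n E x + t * (\<Sum>j<n. x j * adj_mult n E ?e j)
     + t * (\<Sum>j<n. ?e j * adj_mult n E x j) + t\<^sup>2 * (\<Sum>j<n. ?e j * adj_mult n E ?e j)"
    unfolding quad_def lin sum_distrib_left sum.distrib[symmetric]
    by (intro sum.cong) (auto simp: algebra_simps power2_eq_square)
  ultimately show "quad n E (\<lambda>j. x j + t * ?e j) = quad n E x + 2 * t * adj_mult n E x i"
    by (simp only: delta)
  have "sqnorm n (\<lambda>j. x j + t * ?e j) = sqnorm n x + 2 * t * (\<Sum>j<n. ?e j * x j) + t\<^sup>2 * (\<Sum>j<n. ?e j * ?e j)"
    unfolding sqnorm_def sum_distrib_left sum.distrib[symmetric]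
    by (intro sum.cong) (auto simp: algebra_simps power2_eq_square)
  then show "sqnorm n (\<lambda>j. x j + t * ?e j) = sqnorm n x + 2 * t * x i + t\<^sup>2"
    by (simp only: delta) simp
qed

text \<open>First-order condition in coordinate \<open>i\<close>: maximality gives
  \<open>2 * t * c \<le> l * t\<^sup>2\<close> for every \<open>t\<close>. Dividing by
  \<open>\<bar>l\<bar> + 1\<close> in the choice of \<open>t\<close> makes this contradictory unless
  \<open>t = 0\<close>, whatever the sign of \<open>l\<close>.\<close>

lemma rayleigh_maximizer_is_eigenvector:
  assumes "is_graph n E" "i < n" and max: "\<And>y. quad n E y \<le> l * sqnorm n y"
    and eq: "quad n E x = l * sqnorm n x"
  shows "adj_mult n E x i = l * x i"
proof -
  define c where "c = adj_mult n E x i - l * x i"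
  define t where "t = c / (\<bar>l\<bar> + 1)"
  have "2 * t * c \<le> l * t\<^sup>2"
    using max[of "\<lambda>j. x j + t * (if j = i then 1 else 0)"] eq
    unfolding quad_perturb[OF assms(1,2)] c_def by (simp add: algebra_simps)
  moreover have "c = (\<bar>l\<bar> + 1) * t" by (simp add: t_def)
  ultimately have "(2 * (\<bar>l\<bar> + 1) - l) * t\<^sup>2 \<le> 0"
    by (simp add: algebra_simps power2_eq_square)
  moreover have "2 * (\<bar>l\<bar> + 1) - l > 0" using abs_ge_self[of l] abs_ge_zero[of l] by argo
  ultimately have "t\<^sup>2 \<le> 0" by (simp add: mult_le_0_iff)
  then have "t = 0" by simp
  then show ?thesis by (simp add: t_def c_def add_nonneg_eq_0_iff)
qed

text \<open>Vectors are functions on all of \<open>nat\<close>. Pinning them to 0 from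
  \<open>n\<close> on makes the box a product of intervals and singletons, compact by Tychonoff's
  theorem.\<close>

lemma compact_box: "compact {x :: nat \<Rightarrow> real. (\<forall>i<n. x i \<in> {-1..1}) \<and> (\<forall>i\<ge>n. x i = 0)}"
proof -
  have "{x :: nat \<Rightarrow> real. (\<forall>i<n. x i \<in> {-1..1}) \<and> (\<forall>i\<ge>n. x i = 0)}
      = PiE UNIV (\<lambda>i. if i < n then {-1..1} else {0})"
    by (auto simp: PiE_def Pi_def not_le not_less split: if_splits)
  moreover have "compactin (product_topology (\<lambda>_. euclidean) UNIV)
      (PiE UNIV (\<lambda>i. if i < n then {-1..1::real} else {0}))"
    by (subst compactin_PiE) auto
  ultimately show ?thesis by (simp add: euclidean_product_topology)
qed

lemma rayleigh_max_exists:
  assumes "n \<ge> 1"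
  shows "\<exists>l x. sqnorm n x = 1 \<and> quad n E x = l \<and> (\<forall>y. quad n E y \<le> l * sqnorm n y)"
proof -
  define S where "S = {x :: nat \<Rightarrow> real. (\<forall>i<n. x i \<in> {-1..1}) \<and> (\<forall>i\<ge>n. x i = 0)} \<inter> {x. sqnorm n x = 1}"
  have cs: "continuous_on UNIV (sqnorm n)"
    unfolding sqnorm_def by (intro continuous_intros continuous_on_product_coordinates)
  then have "closed {x. sqnorm n x = 1}"
    by (rule closed_Collect_eq) (rule continuous_on_const)
  then have "compact S" unfolding S_def using compact_box by (rule compact_Int_closed[rotated])
  moreover have "(\<lambda>i. if i = 0 then 1 else 0) \<in> S"
    using assms by (auto simp: S_def sqnorm_def if_distrib[of "\<lambda>c. c^2"] sum.delta cong: if_cong)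
  then have "S \<noteq> {}" by blast
  moreover have "continuous_on S (quad n E)"
    unfolding quad_def adj_mult_def
    by (intro continuous_intros continuous_on_subset[OF continuous_on_product_coordinates]) auto
  ultimately obtain x where x: "x \<in> S" "\<And>y. y \<in> S \<Longrightarrow> quad n E y \<le> quad n E x"
    using continuous_attains_sup[of S "quad n E"] by blast
  have "quad n E y \<le> quad n E x * sqnorm n y" for y
  proof (cases "sqnorm n y = 0")
    case True
    then have "\<forall>i<n. y i = 0" using sqnorm_pos[of _ n y] by force
    then have "quad n E y = 0" by (simp add: quad_def)
    then show ?thesis using True by simp
  next
    case False
    then have pos: "sqnorm n y > 0" using sqnorm_nonneg[of n y] by linarith
    define c where "c = 1 / sqrt (sqnorm n y)"
    have c2: "c\<^sup>2 = 1 / sqnorm n y" using pos by (simp add: c_def power_divide)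
    define z where "z = (\<lambda>i. if i < n then c * y i else 0)"
    have z: "sqnorm n z = c\<^sup>2 * sqnorm n y" "quad n E z = c\<^sup>2 * quad n E y"
      unfolding sqnorm_scale[symmetric] quad_scale[symmetric]
      by (simp_all add: sqnorm_def quad_def adj_mult_def z_def)
    have z1: "sqnorm n z = 1" using z(1) c2 pos by simp
    have "\<bar>z i\<bar> \<le> 1" if "i < n" for i
    proof -
      have "(z i)\<^sup>2 \<le> sqnorm n z" unfolding sqnorm_def using that by (intro member_le_sum) auto
      then show ?thesis using z1 by (simp add: abs_square_le_1)
    qed
    then have "z \<in> S" using z1 by (auto simp: S_def z_def abs_le_iff)
    then have "quad n E z \<le> quad n E x" by (rule x(2))
    then show ?thesis using z(2) c2 pos by (simp add: field_simps)
  qed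
  then show ?thesis using x(1) by (auto simp: S_def)
qed

text \<open>Bessel's inequality for the standard basis vector at \<open>i\<close>: \<open>p\<close>
  is its projection to the span of the family, and the squared distance is \<open>1 - s\<close>.
  Summed over \<open>i < n\<close>, it shows that an orthonormal family has at most \<open>n\<close>
  members.\<close>

lemma bessel_coordinate:
  fixes v :: "'a \<Rightarrow> nat \<Rightarrow> real"
  assumes "finite T" "i < n" "\<And>a. a \<in> T \<Longrightarrow> sqnorm n (v a) = 1"
    and orth: "\<And>a b. a \<in> T \<Longrightarrow> b \<in> T \<Longrightarrow> a \<noteq> b \<Longrightarrow> (\<Sum>j<n. v a j * v b j) = 0"
  shows "(\<Sum>a\<in>T. (v a i)\<^sup>2) \<le> 1"
proof -
  define s where "s = (\<Sum>a\<in>T. (v a i)\<^sup>2)"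
  define p where "p j = (\<Sum>a\<in>T. v a i * v a j)" for j
  let ?e = "\<lambda>j. if j = i then 1 else 0 :: real"
  have "0 \<le> (\<Sum>j<n. (?e j - p j)\<^sup>2)" by (intro sum_nonneg) simp
  also have "\<dots> = (\<Sum>j<n. ?e j * (1 - 2 * p j) + (p j)\<^sup>2)"
    by (intro sum.cong) (auto simp: power2_eq_square algebra_simps)
  also have "\<dots> = 1 - 2 * p i + (\<Sum>j<n. (p j)\<^sup>2)"
    using assms(2) by (simp add: sum.distrib if_distrib[of "\<lambda>c. c * _"] sum.delta cong: if_cong)
  also have "p i = s" by (simp add: p_def s_def power2_eq_square)
  also have "(\<Sum>j<n. (p j)\<^sup>2) = s"
  proof -
    have "(\<Sum>j<n. (p j)\<^sup>2) = (\<Sum>j<n. \<Sum>a\<in>T. \<Sum>b\<in>T. (v a i * v b i) * (v a j * v b j))"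
      by (simp add: p_def power2_eq_square sum_product mult_ac)
    also have "\<dots> = (\<Sum>a\<in>T. \<Sum>j<n. \<Sum>b\<in>T. (v a i * v b i) * (v a j * v b j))" by (rule sum.swap)
    also have "\<dots> = (\<Sum>a\<in>T. \<Sum>b\<in>T. \<Sum>j<n. (v a i * v b i) * (v a j * v b j))"
      by (intro sum.cong refl sum.swap)
    also have "\<dots> = (\<Sum>a\<in>T. \<Sum>b\<in>T. (v a i * v b i) * (\<Sum>j<n. v a j * v b j))"
      by (simp add: sum_distrib_left)
    also have "\<dots> = (\<Sum>a\<in>T. \<Sum>b\<in>T. if b = a then (v a i)\<^sup>2 else 0)"
      using assms(3) orth by (intro sum.cong refl) (auto simp: sqnorm_def power2_eq_square)
    finally show ?thesis using assms(1) by (simp add: s_def)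
  qed
  finally show ?thesis by (simp add: s_def)
qed

text \<open>Eigenvectors of distinct eigenvalues are orthogonal, so \<open>n + 1\<close> eigenvalues
  would violate Bessel's inequality. Finiteness is what gives \<open>Max\<close> in
  \<open>spectral_radius\<close> its meaning.\<close>

lemma finite_adj_eigenvalues:
  assumes "is_graph n E"
  shows "finite (adj_eigenvalues n E)"
proof (rule ccontr)
  assume "infinite (adj_eigenvalues n E)"
  then obtain T where T: "finite T" "card T = Suc n" "T \<subseteq> adj_eigenvalues n E"
    using infinite_arbitrarily_large by blast
  have "\<exists>v. sqnorm n v = 1 \<and> (\<forall>i<n. adj_mult n E v i = m * v i)" if "m \<in> T" for m
  proof -
    from that T(3) obtain w where w: "\<exists>i<n. w i \<noteq> 0" "\<forall>i<n. adj_mult n E w i = m * w i"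
      unfolding adj_eigenvalues_def adj_mult_def by blast
    then have pos: "sqnorm n w > 0" using sqnorm_pos by blast
    define c where "c = 1 / sqrt (sqnorm n w)"
    have "c\<^sup>2 = 1 / sqnorm n w" using pos by (simp add: c_def power_divide)
    then have "sqnorm n (\<lambda>i. c * w i) = 1" unfolding sqnorm_scale using pos by simp
    moreover have "adj_mult n E (\<lambda>i. c * w i) i = c * adj_mult n E w i" for i
      by (simp add: adj_mult_def sum_distrib_left mult_ac)
    ultimately show ?thesis using w(2) by (intro exI[of _ "\<lambda>i. c * w i"]) simp
  qed
  then obtain v where v: "\<And>m. m \<in> T \<Longrightarrow> sqnorm n (v m) = 1"
      "\<And>m i. m \<in> T \<Longrightarrow> i < n \<Longrightarrow> adj_mult n E (v m) i = m * v m i"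
    by metis
  have orth: "(\<Sum>j<n. v a j * v b j) = 0" if "a \<in> T" "b \<in> T" "a \<noteq> b" for a b
  proof -
    have "b * (\<Sum>j<n. v a j * v b j) = (\<Sum>j<n. v a j * adj_mult n E (v b) j)"
      using v(2) that by (simp add: sum_distrib_left mult_ac)
    also have "\<dots> = (\<Sum>j<n. v b j * adj_mult n E (v a) j)" by (rule adj_mult_inner_sym[OF assms])
    also have "\<dots> = a * (\<Sum>j<n. v a j * v b j)"
      using v(2) that by (simp add: sum_distrib_left mult_ac)
    finally show ?thesis using that(3) by simp
  qed
  have "real (card T) = (\<Sum>m\<in>T. sqnorm n (v m))" using v(1) by simp
  also have "\<dots> = (\<Sum>i<n. \<Sum>m\<in>T. (v m i)\<^sup>2)" unfolding sqnorm_def by (rule sum.swap)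
  also have "\<dots> \<le> (\<Sum>i<n. 1)"
    using T(1) v(1) orth by (intro sum_mono bessel_coordinate) auto
  finally show False using T(2) by simp
qed

text \<open>The Rayleigh maximum is itself an eigenvalue, since a maximizer is an eigenvector, and
  every eigenvalue is the Rayleigh quotient of its eigenvector. Hence \<open>Max\<close> of the
  spectrum is the Rayleigh maximum.\<close>

lemma spectral_radius_properties:
  assumes "is_graph n E" "n \<ge> 1"
  shows quad_le_spectral_radius: "quad n E y \<le> spectral_radius n E * sqnorm n y"
    and spectral_radius_attained: "\<exists>x. sqnorm n x = 1 \<and> quad n E x = spectral_radius n E"
proof -
  obtain l x where x: "sqnorm n x = 1" "quad n E x = l" "\<And>y. quad n E y \<le> l * sqnorm n y"
    using rayleigh_max_exists[OF assms(2)] by blast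
  \<comment> \<open>Eigenvectors in \<open>adj_eigenvalues\<close> must vanish from \<open>n\<close>
    on, so the maximizer is cut off there.\<close>
  define x' where "x' i = (if i < n then x i else 0)" for i
  have ev: "adj_mult n E x i = l * x i" if "i < n" for i
    by (rule rayleigh_maximizer_is_eigenvector[OF assms(1) that x(3)]) (simp add: x)
  have "\<exists>i<n. x i \<noteq> 0"
  proof (rule ccontr)
    assume "\<not> ?thesis"
    then have "sqnorm n x = 0" by (simp add: sqnorm_def)
    then show False using x(1) by simp
  qed
  moreover have "adj_mult n E x' i = adj_mult n E x i" for i
    by (simp add: adj_mult_def x'_def)
  ultimately have mem: "l \<in> adj_eigenvalues n E"
    unfolding adj_eigenvalues_def using ev
    by (auto intro!: exI[of _ x'] simp: adj_mult_def[symmetric] x'_def)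
  have "m \<le> l" if "m \<in> adj_eigenvalues n E" for m
  proof -
    from that obtain w where w: "\<exists>i<n. w i \<noteq> 0" "\<forall>i<n. adj_mult n E w i = m * w i"
      by (auto simp: adj_eigenvalues_def adj_mult_def)
    then have pos: "sqnorm n w > 0" using sqnorm_pos by blast
    have "quad n E w = m * sqnorm n w"
      using w(2) by (simp add: quad_def sqnorm_def sum_distrib_left power2_eq_square mult_ac)
    then show ?thesis using x(3)[of w] pos by simp
  qed
  then have "spectral_radius n E = l"
    unfolding spectral_radius_def using mem finite_adj_eigenvalues[OF assms(1)] by (intro Max_eqI) auto
  then show "quad n E y \<le> spectral_radius n E * sqnorm n y"
      "\<exists>x. sqnorm n x = 1 \<and> quad n E x = spectral_radius n E"
    using x by auto
qed

text \<open>Passing to absolute values keeps the norm and does not lower the form, so the result is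
  again a maximizer and thus an eigenvector. The graph may be disconnected, so entries may be 0;
  positivity is obtained only at the very end, from the candidate graph.\<close>

lemma perron_vector:
  assumes "is_graph n E" "n \<ge> 1"
  obtains x z where "z < n" "x z = 1" "\<forall>i. 0 \<le> x i \<and> x i \<le> 1"
    "\<forall>i<n. adj_mult n E x i = spectral_radius n E * x i"
proof -
  let ?l = "spectral_radius n E"
  obtain y where y: "sqnorm n y = 1" "quad n E y = ?l"
    using spectral_radius_attained[OF assms] by blast
  define w where "w i = (if i < n then \<bar>y i\<bar> else 0)" for i
  have sw: "sqnorm n w = 1" using y(1) by (simp add: sqnorm_def w_def)
  have "quad n E y \<le> quad n E w"
    unfolding quad_def adj_mult_def sum_distrib_left
  proof (intro sum_mono)
    fix i j assume "i \<in> {..<n}" "j \<in> {..<n}"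
    moreover have "y i * y j \<le> \<bar>y i\<bar> * \<bar>y j\<bar>" by (metis abs_ge_self abs_mult)
    ultimately show "y i * ((if E i j then 1 else 0) * y j) \<le> w i * ((if E i j then 1 else 0) * w j)"
      by (simp add: w_def)
  qed
  then have "quad n E w = ?l * sqnorm n w"
    using y(2) sw quad_le_spectral_radius[OF assms, of w] by simp
  then have ev: "adj_mult n E w i = ?l * w i" if "i < n" for i
    using rayleigh_maximizer_is_eigenvector[OF assms(1) that quad_le_spectral_radius[OF assms]] by blast
  define M where "M = Max (w ` {..<n})"
  have ne: "w ` {..<n} \<noteq> {}" using assms(2) by (auto simp: lessThan_empty_iff)
  then have "M \<in> w ` {..<n}" unfolding M_def by (intro Max_in) auto
  then obtain z where z: "z < n" "w z = M" by auto
  have le: "w i \<le> M" if "i < n" for i unfolding M_def using that by (intro Max_ge) auto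
  have "M > 0"
  proof (rule ccontr)
    assume "\<not> M > 0"
    then have "w i = 0" if "i < n" for i
      using le[OF that] by (auto simp: w_def split: if_splits)
    then have "sqnorm n w = 0" by (simp add: sqnorm_def)
    then show False using sw by simp
  qed
  have "0 \<le> w i / M \<and> w i / M \<le> 1" for i
    using le[of i] \<open>M > 0\<close> by (cases "i < n") (auto simp: w_def)
  moreover have "adj_mult n E (\<lambda>i. w i / M) i = ?l * (w i / M)" if "i < n" for i
  proof -
    have "adj_mult n E (\<lambda>i. w i / M) i = adj_mult n E w i / M"
      by (simp add: adj_mult_def sum_divide_distrib)
    then show ?thesis using ev[OF that] by simp
  qed
  ultimately show thesis using that[of z "\<lambda>i. w i / M"] z \<open>M > 0\<close> by simp
qed

section \<open>The candidate extremal graph\<close>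

lemma graph_iso_sym:
  assumes "graph_iso n E F"
  shows "graph_iso n F E"
proof -
  obtain f where f: "bij_betw f {0..<n} {0..<n}" "\<forall>i<n. \<forall>j<n. E i j \<longleftrightarrow> F (f i) (f j)"
    using assms by (auto simp: graph_iso_def)
  let ?g = "inv_into {0..<n} f"
  have g: "bij_betw ?g {0..<n} {0..<n}" using f(1) by (rule bij_betw_inv_into)
  have "F i j \<longleftrightarrow> E (?g i) (?g j)" if "i < n" "j < n" for i j
  proof -
    have "?g i < n" "?g j < n" using bij_betwE[OF g] that by auto
    moreover have "f (?g i) = i" "f (?g j) = j"
      using bij_betw_inv_into_right[OF f(1)] that by auto
    ultimately show ?thesis using f(2) by auto
  qed
  then show ?thesis using g by (auto simp: graph_iso_def)
qed

lemma contains_cycle_iso: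
  assumes "graph_iso n E F" "contains_cycle n E m"
  shows "contains_cycle n F m"
proof -
  obtain f where f: "bij_betw f {0..<n} {0..<n}" "\<forall>i<n. \<forall>j<n. E i j \<longleftrightarrow> F (f i) (f j)"
    using assms by (auto simp: graph_iso_def)
  obtain vs where vs: "length vs = m" "distinct vs" "set vs \<subseteq> {0..<n}"
      "\<forall>i<m. E (vs ! i) (vs ! ((i + 1) mod m))"
    using assms(2) by (auto simp: contains_cycle_def)
  have "inj_on f (set vs)" using f(1) vs(3) by (meson bij_betw_imp_inj_on inj_on_subset)
  then have "distinct (map f vs)" using vs(2) by (simp add: distinct_map)
  moreover have "set (map f vs) \<subseteq> {0..<n}" using vs(3) bij_betwE[OF f(1)] by auto
  moreover have "F (map f vs ! i) (map f vs ! ((i + 1) mod m))" if "i < m" for i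
  proof -
    have "(i + 1) mod m < m" using that by simp
    then have "vs ! i < n" "vs ! ((i + 1) mod m) < n"
      using vs(1,3) that nth_mem[of _ vs] by (auto simp: subset_iff)
    moreover have "E (vs ! i) (vs ! ((i + 1) mod m))" using vs(4) that by blast
    ultimately have "F (f (vs ! i)) (f (vs ! ((i + 1) mod m)))" using f(2) by blast
    then show ?thesis using vs(1) that \<open>(i + 1) mod m < m\<close> by simp
  qed
  ultimately show ?thesis using vs(1) unfolding contains_cycle_def
    by (intro exI[of _ "map f vs"]) simp
qed

lemma adj_eigenvalues_iso_subset:
  assumes "graph_iso n F E"
  shows "adj_eigenvalues n E \<subseteq> adj_eigenvalues n F"
proof
  fix m assume "m \<in> adj_eigenvalues n E"
  then obtain v where v: "\<exists>i<n. v i \<noteq> 0"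
      "\<And>i. i < n \<Longrightarrow> (\<Sum>j<n. (if E i j then 1 else 0) * v j) = m * v i"
    unfolding adj_eigenvalues_def by blast
  obtain f where f: "bij_betw f {0..<n} {0..<n}" "\<forall>i<n. \<forall>j<n. F i j \<longleftrightarrow> E (f i) (f j)"
    using assms by (auto simp: graph_iso_def)
  have fn: "f i < n" if "i < n" for i using bij_betwE[OF f(1)] that by auto
  define w where "w i = (if i < n then v (f i) else 0)" for i
  have "\<exists>i<n. w i \<noteq> 0"
  proof -
    obtain i where "i < n" "v i \<noteq> 0" using v(1) by blast
    moreover then have "i \<in> f ` {0..<n}" using f(1) by (simp add: bij_betw_def)
    then obtain i' where "i' < n" "f i' = i" by auto
    ultimately show ?thesis by (intro exI[of _ i']) (simp add: w_def)
  qed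
  moreover have "(\<Sum>j<n. (if F i j then 1 else 0) * w j) = m * w i" if i: "i < n" for i
  proof -
    have "(\<Sum>j<n. (if F i j then 1 else 0) * w j) = (\<Sum>j\<in>{0..<n}. (if E (f i) (f j) then 1 else 0) * v (f j))"
      using f(2) i by (intro sum.cong) (auto simp: w_def)
    also have "\<dots> = (\<Sum>j\<in>{0..<n}. (if E (f i) j then 1 else 0) * v j)"
      by (rule sum.reindex_bij_betw[OF f(1)])
    also have "\<dots> = m * w i" using v(2)[OF fn[OF i]] i by (simp add: w_def lessThan_atLeast0)
    finally show ?thesis .
  qed
  ultimately show "m \<in> adj_eigenvalues n F"
    unfolding adj_eigenvalues_def by (intro CollectI exI[of _ w]) (simp add: w_def)
qed

lemma spectral_radius_iso:
  assumes "graph_iso n E F"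
  shows "spectral_radius n E = spectral_radius n F"
proof -
  have "adj_eigenvalues n E = adj_eigenvalues n F"
    using adj_eigenvalues_iso_subset[OF assms] adj_eigenvalues_iso_subset[OF graph_iso_sym[OF assms]]
    by (rule antisym[rotated])
  then show ?thesis by (simp add: spectral_radius_def)
qed

lemma is_graph_S_plus: "is_graph n (S_plus n k)"
  by (auto simp: is_graph_def S_plus_def insert_commute)

text \<open>Each of the at most \<^term>\<open>k\<close> cycle vertices in the clique lies on two cycle edges, so
  at least two edges of the cycle would have to equal the single edge outside the clique.\<close>
lemma S_plus_cycle_free:
  assumes "k \<ge> 2"
  shows "\<not> contains_cycle n (S_plus n k) (2 * k + 2)"
proof
  let ?m = "2 * k + 2"
  define s where "s i = (i + 1) mod ?m" for i
  assume "contains_cycle n (S_plus n k) ?m"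
  then obtain vs where vs: "length vs = ?m" "distinct vs"
     "\<And>i. i < ?m \<Longrightarrow> S_plus n k (vs ! i) (vs ! s i)"
    unfolding contains_cycle_def s_def by blast
  have inj: "inj_on (\<lambda>i. vs ! i) {..<?m}" using vs(1,2) by (auto intro!: inj_onI simp: nth_eq_iff_index_eq)
  have s_eq: "s i = (if i = ?m - 1 then 0 else i + 1)" if "i < ?m" for i
    using that by (auto simp: s_def mod_if)
  have s_lt: "s i < ?m" for i by (simp add: s_def)
  have injs: "inj_on s {..<?m}"
  proof (rule inj_onI)
    fix x y assume "x \<in> {..<?m}" "y \<in> {..<?m}" "s x = s y"
    then show "x = y" using s_eq[of x] s_eq[of y] by (auto split: if_splits)
  qed
  define A where "A = {i \<in> {..<?m}. vs ! i < k}"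
  define B where "B = {i \<in> {..<?m}. vs ! s i < k}"
  have "card A \<le> card {..<k}"
    by (rule card_inj_on_le[of "\<lambda>i. vs ! i"]) (auto simp: A_def intro: inj_on_subset[OF inj])
  moreover have "card B \<le> card {..<k}"
  proof (rule card_inj_on_le[of "\<lambda>i. vs ! s i"])
    have "s ` B \<subseteq> {..<?m}" using s_lt by auto
    then have "inj_on (\<lambda>i. vs ! i) (s ` B)" by (rule inj_on_subset[OF inj])
    moreover have "inj_on s B" by (rule inj_on_subset[OF injs]) (auto simp: B_def)
    ultimately show "inj_on (\<lambda>i. vs ! s i) B" by (simp add: inj_on_def)
  qed (auto simp: B_def)
  moreover have "card (A \<union> B) \<le> card A + card B" by (rule card_Un_le)
  ultimately have "card (A \<union> B) \<le> 2 * k" by simp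
  moreover have "A \<union> B \<union> ({..<?m} - (A \<union> B)) = {..<?m}" by (auto simp: A_def B_def)
  then have "card {..<?m} \<le> card (A \<union> B) + card ({..<?m} - (A \<union> B))"
    using card_Un_le[of "A \<union> B" "{..<?m} - (A \<union> B)"] by (simp only:)
  ultimately have "card ({..<?m} - (A \<union> B)) \<ge> 2" by simp
  then have "\<not> card ({..<?m} - (A \<union> B)) \<le> Suc 0" by linarith
  then obtain i j where ij: "i \<in> {..<?m} - (A \<union> B)" "j \<in> {..<?m} - (A \<union> B)" "i \<noteq> j"
    using card_le_Suc0_iff_eq[of "{..<?m} - (A \<union> B)"] by blast
  have special: "{vs ! l, vs ! s l} = {k, k + 1}" if "l \<in> {..<?m} - (A \<union> B)" for l
    using vs(3)[of l] that by (auto simp: S_plus_def A_def B_def)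
  have eq: "a = b" if "vs ! a = vs ! b" "a < ?m" "b < ?m" for a b
    using that vs(1,2) by (simp add: nth_eq_iff_index_eq)
  have lt: "i < ?m" "j < ?m" "s i < ?m" "s j < ?m" using ij s_lt by auto
  have "vs ! i \<noteq> vs ! j" using eq[of i j] lt ij(3) by blast
  \<comment> \<open>Two distinct cycle edges with the same pair of ends force \<open>i\<close> and
    \<open>j\<close> to be each other's successor, which is impossible on a cycle of more than two
    vertices.\<close>
  then have "vs ! i = vs ! s j" "vs ! j = vs ! s i"
    using special[OF ij(1)] special[OF ij(2)] unfolding doubleton_eq_iff by metis+
  then have "s j = i" "s i = j" using eq lt by metis+
  then have "j = (if i = ?m - 1 then 0 else i + 1)" "i = (if j = ?m - 1 then 0 else j + 1)"
    using s_eq[OF lt(1)] s_eq[OF lt(2)] by metis+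
  then show False using assms by presburger
qed

text \<open>The test vector \<open>y\<close> is the Perron vector of the complete bipartite subgraph
  between the clique and the rest, with eigenvalue \<open>a * b\<close>. The remaining edges can
  only increase the form.\<close>

lemma S_plus_spectral_radius:
  assumes "k \<ge> 1" "n > k"
  shows "real k * (real n - real k) \<le> (spectral_radius n (S_plus n k))\<^sup>2"
    and "0 \<le> spectral_radius n (S_plus n k)"
proof -
  let ?l = "spectral_radius n (S_plus n k)"
  define a where "a = sqrt (real n - real k)"
  define b where "b = sqrt (real k)"
  have ab: "a > 0" "b > 0" "a\<^sup>2 = real n - real k" "b\<^sup>2 = real k" using assms by (auto simp: a_def b_def)
  define y where "y i = (if i < k then a else b)" for i
  have split: "{..<n} = {..<k} \<union> {k..<n}" "{..<k} \<inter> {k..<n} = {}" using assms by auto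
  have "sqnorm n y = real k * a\<^sup>2 + (real n - real k) * b\<^sup>2"
    unfolding sqnorm_def split(1) using assms
    by (subst sum.union_disjoint) (auto simp: y_def of_nat_diff)
  then have sq: "sqnorm n y = 2 * (a\<^sup>2 * b\<^sup>2)" by (simp add: ab)
  have low: "adj_mult n (S_plus n k) y i \<ge> (real n - real k) * b" if "i < k" for i
  proof -
    have "(real n - real k) * b = (\<Sum>j\<in>{k..<n}. b)" using assms by (simp add: of_nat_diff)
    also have "\<dots> = (\<Sum>j\<in>{k..<n}. y j)" by (simp add: y_def)
    also have "\<dots> \<le> (\<Sum>j | j < n \<and> S_plus n k i j. y j)"
      using that assms ab by (intro sum_mono2) (auto simp: S_plus_def y_def)
    finally show ?thesis by (simp add: adj_mult_eq_sum)
  qed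
  have high: "adj_mult n (S_plus n k) y i \<ge> real k * a" if "i \<in> {k..<n}" for i
  proof -
    have "real k * a = (\<Sum>j\<in>{..<k}. y j)" by (simp add: y_def)
    also have "\<dots> \<le> (\<Sum>j | j < n \<and> S_plus n k i j. y j)"
      using that assms ab by (intro sum_mono2) (auto simp: S_plus_def y_def)
    finally show ?thesis by (simp add: adj_mult_eq_sum)
  qed
  have "quad n (S_plus n k) y = (\<Sum>i<k. y i * adj_mult n (S_plus n k) y i) + (\<Sum>i=k..<n. y i * adj_mult n (S_plus n k) y i)"
    unfolding quad_def split(1) by (rule sum.union_disjoint) auto
  also have "\<dots> \<ge> (\<Sum>i<k. a * ((real n - real k) * b)) + (\<Sum>i=k..<n. b * (real k * a))"
    using low high ab by (intro add_mono sum_mono) (auto simp: y_def intro!: mult_left_mono)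
  also have "(\<Sum>i<k. a * ((real n - real k) * b)) + (\<Sum>i=k..<n. b * (real k * a)) = 2 * (a\<^sup>2 * b\<^sup>2) * (a * b)"
    using assms by (simp add: ab of_nat_diff)
  finally have "2 * (a\<^sup>2 * b\<^sup>2) * (a * b) \<le> ?l * (2 * (a\<^sup>2 * b\<^sup>2))"
    using quad_le_spectral_radius[OF is_graph_S_plus, of n k y] assms sq by simp
  then have "(a * b) * (2 * (a\<^sup>2 * b\<^sup>2)) \<le> ?l * (2 * (a\<^sup>2 * b\<^sup>2))" by (simp only: mult_ac)
  moreover have "2 * (a\<^sup>2 * b\<^sup>2) > 0" using ab(1,2) by simp
  ultimately have *: "a * b \<le> ?l" by (rule mult_right_le_imp_le)
  then show "0 \<le> ?l" using ab by (metis less_eq_real_def mult_pos_pos order_trans)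
  have "(a * b)\<^sup>2 \<le> ?l\<^sup>2" using * ab by (intro power_mono) auto
  then show "real k * (real n - real k) \<le> ?l\<^sup>2" by (simp add: power_mult_distrib ab mult.commute)
qed

section \<open>From uniqueness to the set of extremal graphs\<close>

lemma finite_graphs: "finite {E. is_graph n E}"
proof -
  have "inj_on (\<lambda>E. {(i, j). E i j}) {E. is_graph n E}"
    by (auto simp: inj_on_def fun_eq_iff set_eq_iff)
  moreover have "(\<lambda>E. {(i, j). E i j}) ` {E. is_graph n E} \<subseteq> Pow ({..<n} \<times> {..<n})"
    by (auto simp: is_graph_def)
  ultimately show ?thesis by (meson finite_Pow_iff finite_SigmaI finite_lessThan inj_on_finite)
qed

text \<open>It suffices to treat competitors whose spectral radius is at least the candidate's: one
  with a strictly larger radius would be isomorphic to the candidate and hence have the same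
  radius.\<close>

lemma SPEX_eq_iso_class:
  assumes k: "k \<ge> 2"
    and unique: "\<And>E. is_graph n E \<Longrightarrow> \<not> contains_cycle n E (2 * k + 2) \<Longrightarrow>
      spectral_radius n (S_plus n k) \<le> spectral_radius n E \<Longrightarrow> graph_iso n E (S_plus n k)"
  shows "E \<in> SPEX n (2 * k + 2) \<longleftrightarrow> is_graph n E \<and> graph_iso n E (S_plus n k)"
proof -
  let ?G = "{spectral_radius n E | E. is_graph n E \<and> \<not> contains_cycle n E (2 * k + 2)}"
  have "?G \<subseteq> spectral_radius n ` {E. is_graph n E}" by auto
  then have fin: "finite ?G" using finite_graphs finite_surj by blast
  have S: "is_graph n (S_plus n k)" "\<not> contains_cycle n (S_plus n k) (2 * k + 2)"
    using is_graph_S_plus S_plus_cycle_free[OF k] by auto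
  have "spectral_radius n E \<le> spectral_radius n (S_plus n k)"
    if "is_graph n E" "\<not> contains_cycle n E (2 * k + 2)" for E
    using unique[OF that] spectral_radius_iso by fastforce
  then have spex: "spex n (2 * k + 2) = spectral_radius n (S_plus n k)"
    unfolding spex_def using S fin by (intro Max_eqI) auto
  show ?thesis
  proof
    assume "E \<in> SPEX n (2 * k + 2)"
    then show "is_graph n E \<and> graph_iso n E (S_plus n k)"
      using unique[of E] spex by (auto simp: SPEX_def)
  next
    assume E: "is_graph n E \<and> graph_iso n E (S_plus n k)"
    then have "\<not> contains_cycle n E (2 * k + 2)" using contains_cycle_iso S(2) by blast
    then show "E \<in> SPEX n (2 * k + 2)"
      using E spex spectral_radius_iso by (auto simp: SPEX_def)
  qed
qed

section \<open>Heavy vertices of an extremal graph\<close>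

text \<open>With equal lengths, \<open>splice\<close> alternates strictly, from \<open>hd xs\<close>
  to \<open>last ys\<close>. Every cycle through a complete bipartite piece below is assembled from
  such a path.\<close>

lemma splice_path:
  assumes "length xs = length ys" "distinct xs" "distinct ys" "set xs \<inter> set ys = {}" "xs \<noteq> []"
    "\<And>a b. a \<in> set xs \<Longrightarrow> b \<in> set ys \<Longrightarrow> E a b \<and> E b a"
  shows "distinct (splice xs ys)" "successively E (splice xs ys)" "set (splice xs ys) = set xs \<union> set ys"
    "hd (splice xs ys) = hd xs" "last (splice xs ys) = last ys"
  using assms
proof (induction xs ys rule: list_induct2)
  case (Cons a xs b ys)
  {
    case 1 then show ?case using Cons by (cases xs) auto
  next
    case 2 then show ?case using Cons by (cases xs; cases ys) (auto simp: successively_Cons)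
  next
    case 3 then show ?case using Cons by (cases xs) auto
  next
    case 4 then show ?case by simp
  next
    case 5 then show ?case using Cons by (cases xs) auto
  }
qed auto

context cycle_free
begin

lemma card_N_le: "card (N v) \<le> n"
  using card_mono[OF _ N_subset, of v] by simp

lemma common_neighbours_le:
  assumes "finite S" "card S = Suc k"
  shows "card {u. \<forall>s\<in>S. E s u} \<le> k"
proof (rule ccontr)
  let ?C = "{u. \<forall>s\<in>S. E s u}"
  assume "\<not> ?thesis"
  then have "Suc k \<le> card ?C" by simp
  then obtain C where C: "C \<subseteq> ?C" "card C = Suc k" "finite C"
    by (rule obtain_subset_with_card_n)
  obtain xs where xs: "set xs = S" "distinct xs" using finite_distinct_list assms(1) by blast
  obtain ys where ys: "set ys = C" "distinct ys" using finite_distinct_list C(3) by blast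
  have len: "length xs = Suc k" "length ys = Suc k" using xs ys assms C distinct_card[of xs] distinct_card[of ys] by simp_all
  have CS: "E a b" if "a \<in> S" "b \<in> C" for a b using that C(1) by blast
  then have "u \<notin> C" if "u \<in> S" for u using that E_irrefl[of u] by blast
  then have dis: "set xs \<inter> set ys = {}" using xs(1) ys(1) by blast
  have adj: "E a b \<and> E b a" if "a \<in> set xs" "b \<in> set ys" for a b
    using CS[of a b] that xs(1) ys(1) E_sym[of a b] by simp
  have ne: "xs \<noteq> []" "ys \<noteq> []" using len by auto
  note p = splice_path[of xs ys E, OF _ xs(2) ys(2) dis ne(1) adj]
  show False
    using no_cycle[of "splice xs ys"] p len ne adj[of "hd xs" "last ys"] by simp
qed

text \<open>Each such \<open>u\<close> is a common neighbour of some \<open>Suc k\<close> members of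
  \<open>L\<close>; there are at most \<open>2 ^ T\<close> such subsets with at most
  \<open>k\<close> common neighbours each. The bound is independent of \<open>n\<close>.\<close>

lemma many_neighbours_le:
  assumes "finite L" "card L \<le> T"
  shows "card {u. k < card (N u \<inter> L)} \<le> 2 ^ T * k"
proof -
  let ?F = "{S \<in> Pow L. card S = Suc k}"
  have finF: "finite ?F" using assms(1) by simp
  have fin: "finite {u. \<forall>s\<in>S. E s u}" if S: "S \<in> ?F" for S
  proof -
    obtain s where "s \<in> S" using S by fastforce
    then have "{u. \<forall>s\<in>S. E s u} \<subseteq> N s" by auto
    then show ?thesis using finite_N finite_subset by blast
  qed
  have "{u. k < card (N u \<inter> L)} \<subseteq> (\<Union>S\<in>?F. {u. \<forall>s\<in>S. E s u})"
  proof
    fix u assume "u \<in> {u. k < card (N u \<inter> L)}"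
    then have "Suc k \<le> card (N u \<inter> L)" by simp
    then obtain S where "S \<subseteq> N u \<inter> L" "card S = Suc k" "finite S"
      by (rule obtain_subset_with_card_n)
    moreover then have "E s u" if "s \<in> S" for s using that E_sym[of u s] by auto
    ultimately have "S \<in> ?F \<and> (\<forall>s\<in>S. E s u)" by auto
    then show "u \<in> (\<Union>S\<in>?F. {u. \<forall>s\<in>S. E s u})" by blast
  qed
  then have "card {u. k < card (N u \<inter> L)} \<le> card (\<Union>S\<in>?F. {u. \<forall>s\<in>S. E s u})"
    using finF fin by (intro card_mono) auto
  also have "\<dots> \<le> (\<Sum>S\<in>?F. card {u. \<forall>s\<in>S. E s u})" by (rule card_UN_le[OF finF])
  also have "\<dots> \<le> (\<Sum>S\<in>?F. k)"
    using assms(1) by (intro sum_mono common_neighbours_le) (auto intro: finite_subset)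
  also have "\<dots> = card ?F * k" by simp
  also have "\<dots> \<le> card (Pow L) * k" using assms(1) by (intro mult_le_mono1 card_mono) auto
  also have "\<dots> \<le> 2 ^ T * k" using assms by (intro mult_le_mono1) (simp add: card_Pow)
  finally show ?thesis .
qed

text \<open>Walks that return to \<open>v\<close> are excluded in \<open>two_walks_le\<close>; there
  is one for each neighbour of \<open>v\<close>, which gives the extra
  \<open>card (N v)\<close>.\<close>

lemma two_walks_le_all:
  assumes "W \<subseteq> {..<n}"
  shows "(\<Sum>u\<in>N v. card (N u \<inter> W)) \<le> (2 * k + 2) * (card (N v) + card W) + card (N v)"
proof -
  have finW: "finite W" using assms finite_subset by blast
  have "(\<Sum>u\<in>N v. card (N u \<inter> W)) \<le> (\<Sum>u\<in>N v. card (N u \<inter> (W - {v})) + 1)"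
  proof (intro sum_mono)
    fix u
    have "card (N u \<inter> W) \<le> card (insert v (N u \<inter> (W - {v})))"
      using finW by (intro card_mono) auto
    also have "\<dots> \<le> card (N u \<inter> (W - {v})) + 1" by (simp add: card_insert_if)
    finally show "card (N u \<inter> W) \<le> card (N u \<inter> (W - {v})) + 1" .
  qed
  also have "\<dots> = (\<Sum>u\<in>N v. card (N u \<inter> (W - {v}))) + card (N v)" by (subst sum.distrib) simp
  also have "(\<Sum>u\<in>N v. card (N u \<inter> (W - {v}))) \<le> (2 * k + 2) * (card (N v) + card (W - {v}))"
    using assms by (intro two_walks_le) auto
  also have "\<dots> \<le> (2 * k + 2) * (card (N v) + card W)"
    using finW by (intro mult_le_mono2 add_left_mono card_mono) auto
  finally show ?thesis by simp
qed

end

section \<open>Walks of length two and large entries of the Perron vector\<close>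

locale perron = cycle_free +
  fixes x :: "nat \<Rightarrow> real" and l :: real and z :: nat
  assumes x_nonneg: "0 \<le> x i" and x_le_1: "x i \<le> 1" and z_lt: "z < n" and x_z: "x z = 1"
    and eig: "i < n \<Longrightarrow> (\<Sum>j\<in>N i. x j) = l * x i"
    and l_nonneg: "0 \<le> l" and l_sq: "real k * (real n - real k) \<le> l\<^sup>2"
begin

definition L :: "real \<Rightarrow> nat set" where "L c = {w. w < n \<and> c \<le> x w}"

lemma L_subset: "L c \<subseteq> {..<n}" by (auto simp: L_def)
lemma finite_L [simp]: "finite (L c)" using L_subset finite_subset by blast

lemma two_walk_eq:
  assumes "v < n"
  shows "l\<^sup>2 * x v = (\<Sum>u\<in>N v. \<Sum>w\<in>N u. x w)"
proof -
  have "(\<Sum>u\<in>N v. \<Sum>w\<in>N u. x w) = (\<Sum>u\<in>N v. l * x u)"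
    using E_lt by (intro sum.cong eig) auto
  also have "\<dots> = l\<^sup>2 * x v" using eig[OF assms] by (simp add: sum_distrib_left[symmetric] power2_eq_square)
  finally show ?thesis by simp
qed

lemma sum_N_split:
  assumes "0 \<le> c"
  shows "(\<Sum>w\<in>N u. x w) \<le> (\<Sum>w\<in>N u \<inter> L c. x w) + c * card (N u)"
proof -
  have "(\<Sum>w\<in>N u. x w) = (\<Sum>w\<in>N u \<inter> L c. x w) + (\<Sum>w\<in>N u - L c. x w)"
    by (simp add: sum.Int_Diff[of "N u" x "L c"])
  also have "(\<Sum>w\<in>N u - L c. x w) \<le> (\<Sum>w\<in>N u - L c. c)"
    using N_subset[of u] by (intro sum_mono) (auto simp: L_def)
  also have "\<dots> \<le> c * card (N u)"
    using assms card_mono[of "N u" "N u - L c"] by (simp add: mult.commute mult_left_mono)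
  finally show ?thesis by simp
qed

text \<open>Walks ending at a light vertex contribute at most \<open>c\<close> each, and sparsity
  leaves only linearly many walks of length two from \<open>v\<close>. The constant is 4k + 5 = 2(2k
  + 2) + 1.\<close>

lemma two_walk_heavy:
  assumes "v < n" "0 \<le> c"
  shows "l\<^sup>2 * x v \<le> (\<Sum>u\<in>N v. \<Sum>w\<in>N u \<inter> L c. x w) + c * (4 * k + 5) * n"
proof -
  have "l\<^sup>2 * x v \<le> (\<Sum>u\<in>N v. (\<Sum>w\<in>N u \<inter> L c. x w) + c * card (N u))"
    unfolding two_walk_eq[OF assms(1)] by (intro sum_mono sum_N_split assms)
  also have "\<dots> = (\<Sum>u\<in>N v. \<Sum>w\<in>N u \<inter> L c. x w) + c * (\<Sum>u\<in>N v. card (N u))"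
    by (simp add: sum.distrib sum_distrib_left)
  also have "(\<Sum>u\<in>N v. card (N u)) = (\<Sum>u\<in>N v. card (N u \<inter> {..<n}))"
    using N_subset by (simp add: Int_absorb2)
  also have "(\<Sum>u\<in>N v. card (N u \<inter> {..<n})) \<le> (4 * k + 5) * n"
  proof -
    have "(\<Sum>u\<in>N v. card (N u \<inter> {..<n})) \<le> (2 * k + 2) * (card (N v) + n) + card (N v)"
      using two_walks_le_all[of "{..<n}" v] by simp
    also have "\<dots> \<le> (2 * k + 2) * (n + n) + n"
      using card_N_le by (intro add_mono mult_le_mono2) auto
    finally show ?thesis by (simp add: algebra_simps)
  qed
  finally show ?thesis using assms(2) by (simp add: mult_left_mono mult.assoc)
qed

text \<open>Turns a large entry into a large degree: once \<open>L c\<close> is small and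
  \<open>c\<close> is a small constant, the last two terms are a small fraction of \<open>n\<close>,
  so the first must carry the left side.\<close>

lemma two_walk_degree:
  fixes c :: real
  assumes "v < n" "0 \<le> c" "c \<le> 1"
  shows "l\<^sup>2 * x v \<le> (4 * k + 6) * card (N v) + (2 * k + 2) * card (L c) + c * (2 * k + 2) * n"
proof -
  let ?K = "2 * k + 2"
  have "l\<^sup>2 * x v \<le> (\<Sum>u\<in>N v. real (card (N u \<inter> L c)) + c * card (N u))"
    unfolding two_walk_eq[OF assms(1)]
  proof (intro sum_mono)
    fix u
    have "(\<Sum>w\<in>N u \<inter> L c. x w) \<le> (\<Sum>w\<in>N u \<inter> L c. 1)" by (intro sum_mono x_le_1)
    then show "(\<Sum>w\<in>N u. x w) \<le> real (card (N u \<inter> L c)) + c * card (N u)"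
      using sum_N_split[OF assms(2), of u] by simp
  qed
  also have "\<dots> = real (\<Sum>u\<in>N v. card (N u \<inter> L c)) + c * real (\<Sum>u\<in>N v. card (N u \<inter> {..<n}))"
    using N_subset by (simp add: sum.distrib sum_distrib_left Int_absorb2)
  also have "\<dots> \<le> real (?K * (card (N v) + card (L c)) + card (N v))
      + c * real (?K * (card (N v) + n) + card (N v))"
    using two_walks_le_all[OF L_subset[of c], of v] two_walks_le_all[of "{..<n}" v] assms(2)
    by (intro add_mono mult_left_mono of_nat_mono) auto
  also have "\<dots> = (2 * k + 3) * card (N v) + ?K * card (L c) + c * ?K * n + c * ((2 * k + 3) * card (N v))"
    by (simp add: algebra_simps)
  also have "c * ((2 * k + 3) * card (N v)) \<le> 1 * real ((2 * k + 3) * card (N v))"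
    using assms(3) by (intro mult_right_mono) auto
  finally show ?thesis by (simp add: algebra_simps)
qed

lemma l_ge_sqrt:
  assumes "2 * k \<le> n"
  shows "real n \<le> l\<^sup>2" "sqrt n \<le> l"
proof -
  have "real (2 * k) \<le> real n" using assms by (simp only: of_nat_le_iff)
  then have kn: "2 * real k \<le> real n" by simp
  then have "real n \<le> 2 * (real n - real k)" by (simp add: algebra_simps)
  also have "\<dots> \<le> real k * (real n - real k)" using k2 kn by (intro mult_right_mono) auto
  finally show "real n \<le> l\<^sup>2" using l_sq by simp
  then show "sqrt n \<le> l" using l_nonneg by (simp add: real_le_lsqrt)
qed

text \<open>As entries are at most 1, the eigenvalue equation gives a vertex of \<open>L c\<close>
  degree at least \<open>c * l\<close>; the edge bound then limits how many there are.\<close>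

lemma card_L_edge_bound:
  assumes "0 \<le> c" "8 * (2 * k + 2) \<le> D" "D ^ 3 > 8 * (2 * k + 2)^2 * n"
  shows "c * l * card (L c) \<le> 2 * D * n"
proof -
  have "c * l * card (L c) = (\<Sum>v\<in>L c. c * l)" by simp
  also have "\<dots> \<le> (\<Sum>v\<in>L c. real (card (N v)))"
  proof (intro sum_mono)
    fix v assume v: "v \<in> L c"
    have "c * l \<le> l * x v" using v mult_left_mono[OF _ l_nonneg, of c "x v"] by (simp add: L_def mult.commute)
    also have "\<dots> = (\<Sum>j\<in>N v. x j)" using eig v by (simp add: L_def)
    also have "\<dots> \<le> (\<Sum>j\<in>N v. 1)" by (intro sum_mono x_le_1)
    finally show "c * l \<le> real (card (N v))" by simp
  qed
  also have "\<dots> \<le> (\<Sum>v<n. real (card (N v)))" using L_subset by (intro sum_mono2) auto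
  also have "\<dots> = real (epairs E {..<n} {..<n})"
  proof -
    have "{b \<in> {..<n}. E a b} = N a" for a using N_subset by auto
    then show ?thesis by (simp add: epairs_eq_sum)
  qed
  also have "\<dots> \<le> real (2 * D * n)" using edge_bound[OF assms(2,3)] by (intro of_nat_mono)
  finally show ?thesis by simp
qed

end

section \<open>Bounds for large n, uniform in the graph\<close>

lemma eventually_sqrt_ge: "\<forall>\<^sub>F n in sequentially. X \<le> sqrt (real n)"
  using filterlim_compose[OF sqrt_at_top filterlim_real_sequentially]
  by (auto simp: filterlim_at_top)

lemma eventually_real_ge: "\<forall>\<^sub>F n in sequentially. X \<le> real n"
  using filterlim_real_sequentially by (auto simp: filterlim_at_top)

text \<open>\<open>D\<close> may be of order sqrt n with a small factor: this is far above the
  n^(1/3) that \<open>edge_bound\<close> demands, yet small enough for the conclusion. Graph and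
  eigenvector are quantified inside the eventuality, so the threshold for \<open>n\<close> does not
  depend on them.\<close>

lemma few_heavy:
  fixes c d :: real
  assumes "0 < c" "0 < d"
  shows "\<forall>\<^sub>F n in sequentially. \<forall>E x l z. perron n k E x l z \<longrightarrow> real (card (perron.L n x c)) \<le> d * n"
proof -
  \<comment> \<open>Chosen so that \<open>2 * (g * s) * n = c * s * (d * n)\<close> for
    \<open>s\<close> = sqrt n.\<close>
  define g where "g = c * d / 2"
  have g: "g > 0" using assms by (simp add: g_def)
  define K where "K = real (2 * k + 2)"
  have K: "K > 0" by (simp add: K_def)
  have e1: "\<forall>\<^sub>F n in sequentially. 2 / g * (8 * K) + 2 / g \<le> sqrt (real n)"
    and e2: "\<forall>\<^sub>F n in sequentially. 64 * K\<^sup>2 / g ^ 3 + 1 \<le> sqrt (real n)" by (rule eventually_sqrt_ge)+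
  have e3: "\<forall>\<^sub>F n in sequentially. real (2 * k) + 1 \<le> real n" by (rule eventually_real_ge)
  from e1 e2 e3 show ?thesis
  proof eventually_elim
    case (elim n)
    define s where "s = sqrt (real n)"
    define D where "D = nat \<lfloor>g * s\<rfloor>"
    have s: "s \<ge> 0" "s\<^sup>2 = real n" by (simp_all add: s_def)
    have "2 * (8 * K) + 2 \<le> g * s" using elim(1) g by (simp add: s_def field_simps)
    then have D: "real D \<le> g * s" "real D \<ge> g * s / 2" "real D \<ge> 8 * K"
      using K by (auto simp: D_def) linarith+
    have "64 * K\<^sup>2 < g ^ 3 * s"
    proof -
      have "64 * K\<^sup>2 / g ^ 3 < s" using elim(2) by (simp add: s_def)
      then show ?thesis using g by (simp add: field_simps)
    qed
    moreover have "real n > 0" using elim(3) by simp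
    ultimately have "64 * K\<^sup>2 * real n < g ^ 3 * s * real n" by (rule mult_strict_right_mono)
    also have "\<dots> = 8 * (g * s / 2) ^ 3" using s(2) by (simp add: field_simps power2_eq_square power3_eq_cube)
    also have "\<dots> \<le> 8 * real D ^ 3" using D g s by (intro mult_left_mono power_mono) auto
    finally have "real (8 * (2 * k + 2)^2 * n) < real (D ^ 3)" by (simp add: K_def mult_ac)
    then have D3: "8 * (2 * k + 2)^2 * n < D ^ 3" by (simp only: of_nat_less_iff)
    have "real (8 * (2 * k + 2)) \<le> real D" using D(3) by (simp add: K_def)
    then have D8: "8 * (2 * k + 2) \<le> D" by (simp only: of_nat_le_iff)
    show ?case
    proof (intro allI impI)
      fix E x l z assume "perron n k E x l z"
      then interpret perron n k E x l z .
      have "c * s * card (L c) \<le> c * l * card (L c)"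
        using l_ge_sqrt(2) elim(3) assms(1) by (intro mult_right_mono mult_left_mono) (auto simp: s_def)
      also have "\<dots> \<le> 2 * D * n" using assms D8 D3 by (intro card_L_edge_bound) auto
      also have "\<dots> \<le> 2 * (g * s) * n" using D(1) by (simp add: mult_right_mono)
      also have "\<dots> = c * s * (d * n)" by (simp add: g_def)
      finally have "c * s * card (L c) \<le> c * s * (d * n)" .
      moreover have "c * s > 0" using assms(1) elim(3) by (simp add: s_def)
      ultimately show "real (card (L c)) \<le> d * n" by (simp only: mult_le_cancel_left_pos)
    qed
  qed
qed

lemma heavy_degree:
  fixes c :: real
  assumes "0 < c"
  shows "\<forall>\<^sub>F n in sequentially. \<forall>E x l z. perron n k E x l z \<longrightarrow>
    (\<forall>v\<in>perron.L n x c. c / (8 * k + 12) * n \<le> card (cycle_free.N E v))"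
proof -
  define K where "K = real (2 * k + 2)"
  have K: "K \<ge> 1" by (simp add: K_def)
  \<comment> \<open>With this threshold each of the two error terms of
    \<open>two_walk_degree\<close> is at most a quarter of \<open>c * n\<close>; half of it is left
    for the degree term.\<close>
  define a where "a = c / (4 * K)"
  have a: "a > 0" using assms K by (simp add: a_def)
  have e3: "\<forall>\<^sub>F n in sequentially. real (2 * k) + 1 \<le> real n" by (rule eventually_real_ge)
  from few_heavy[OF a a, of k] e3 show ?thesis
  proof eventually_elim
    case (elim n)
    show ?case
    proof (intro allI impI ballI)
      fix E x l z v assume "perron n k E x l z"
      then interpret perron n k E x l z .
      assume v: "v \<in> L c"
      have La: "real (card (L a)) \<le> a * n" using elim(1) perron_axioms by blast
      have "c \<le> 1" using v x_le_1[of v] by (simp add: L_def)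
      then have "a \<le> 1" using K by (simp add: a_def field_simps)
      have "c * n \<le> l\<^sup>2 * x v"
        using l_ge_sqrt(1) elim(2) v assms by (subst mult.commute, intro mult_mono) (auto simp: L_def)
      also have "\<dots> \<le> (4 * k + 6) * card (N v) + K * card (L a) + a * K * n"
        using two_walk_degree[of v a] v a \<open>a \<le> 1\<close> by (simp add: L_def K_def algebra_simps)
      also have "K * card (L a) \<le> K * (a * n)" using La K by (intro mult_left_mono) auto
      also have "K * (a * n) = c / 4 * n" using K by (simp add: a_def)
      also have "a * K * n = c / 4 * n" using K by (simp add: a_def)
      finally have "c * n / 2 \<le> (4 * k + 6) * card (N v)" by simp
      then show "c / (8 * k + 12) * n \<le> card (N v)" by (simp add: field_simps)
    qed
  qed
qed

text \<open>Double counting: \<open>t\<close> heavy vertices of degree at least \<open>d * n\<close>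
  send out at least \<open>(k + 1) * n\<close> edges. But all except \<open>2 ^ t * k\<close>
  vertices receive at most \<open>k\<close> of them, a contradiction for large
  \<open>n\<close>.\<close>

lemma heavy_bounded:
  fixes c :: real
  assumes "0 < c"
  shows "\<exists>T. \<forall>\<^sub>F n in sequentially. \<forall>E x l z. perron n k E x l z \<longrightarrow> card (perron.L n x c) \<le> T"
proof -
  define d where "d = c / (8 * k + 12)"
  have d: "d > 0" using assms by (simp add: d_def)
  define t where "t = nat \<lceil>(k + 1) / d\<rceil>"
  have t: "real t * d \<ge> k + 1"
  proof -
    have "(k + 1) / d \<le> real t" unfolding t_def by (rule real_nat_ceiling_ge)
    then show ?thesis using d by (simp add: field_simps)
  qed
  have e: "\<forall>\<^sub>F n in sequentially. real (t * (2 ^ t * k)) + 1 \<le> real n" by (rule eventually_real_ge)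
  have "\<forall>\<^sub>F n in sequentially. \<forall>E x l z. perron n k E x l z \<longrightarrow> card (perron.L n x c) \<le> t"
    using heavy_degree[OF assms, of k] e
  proof eventually_elim
    case (elim n)
    show ?case
    proof (intro allI impI, rule ccontr)
      fix E x l z assume "perron n k E x l z"
      then interpret perron n k E x l z .
      assume "\<not> card (L c) \<le> t"
      then obtain S where S: "S \<subseteq> L c" "card S = t" "finite S"
        by (metis obtain_subset_with_card_n nat_le_linear finite_L finite_subset)
      let ?B = "{u. k < card (N u \<inter> S)}"
      have Bn: "?B \<subseteq> {..<n}"
      proof
        fix u assume "u \<in> ?B"
        then have "N u \<noteq> {}" by auto
        then show "u \<in> {..<n}" using E_lt by auto
      qed
      have Sn: "S \<subseteq> {..<n}" using S(1) L_subset by blast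
      have "(k + 1) * real n \<le> (real t * d) * n" using t by (intro mult_right_mono) auto
      also have "\<dots> = (\<Sum>v\<in>S. d * n)" using S(2) by simp
      also have "\<dots> \<le> (\<Sum>v\<in>S. real (card (N v)))"
        using elim(1) perron_axioms S(1) unfolding d_def by (intro sum_mono) blast
      also have "\<dots> = real (epairs E S {..<n})"
      proof -
        have "{b \<in> {..<n}. E a b} = N a" for a using N_subset by auto
        then show ?thesis using S(3) by (simp add: epairs_eq_sum)
      qed
      also have "epairs E S {..<n} = (\<Sum>u<n. card (N u \<inter> S))"
      proof -
        have "{a \<in> S. E a u} = N u \<inter> S" for u using E_sym by auto
        then show ?thesis using S(3) by (simp add: epairs_eq_sum_right)
      qed
      also have "\<dots> \<le> (\<Sum>u<n. k + (if u \<in> ?B then t else 0))"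
      proof (intro sum_mono)
        fix u
        have "card (N u \<inter> S) \<le> t" using S card_mono[of S "N u \<inter> S"] by auto
        then show "card (N u \<inter> S) \<le> k + (if u \<in> ?B then t else 0)" by auto
      qed
      also have "\<dots> = n * k + card ?B * t"
        using Bn by (simp add: sum.distrib sum.If_cases Int_absorb1 Int_absorb2 del: mem_Collect_eq)
      also have "\<dots> \<le> n * k + 2 ^ t * k * t"
        using many_neighbours_le[of S t] S by (intro add_left_mono mult_le_mono1) auto
      finally have "(k + 1) * real n \<le> real (n * k + 2 ^ t * k * t)" by simp
      then show False using elim(2) by (simp add: algebra_simps)
    qed
  qed
  then show ?thesis by blast
qed

section \<open>Exactly k heavy vertices sharing almost all neighbours\<close>

context perron
begin

lemma sum_heavy_le_card: "(\<Sum>w\<in>N u \<inter> L c. x w) \<le> card (N u \<inter> L c)"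
  using sum_mono[of "N u \<inter> L c" x "\<lambda>_. 1"] x_le_1 by simp

text \<open>The neighbours of \<open>v\<close> are of three kinds: boundedly many with more than
  \<open>k\<close> heavy neighbours, each contributing at most \<open>T\<close>; good ones,
  contributing at most \<open>k\<close>; and the rest, contributing at most \<open>k - t\<close>. At
  \<open>v = z\<close> the total is nearly \<open>k * n\<close>, so almost every vertex must be
  good.\<close>

lemma sum_heavy_bound:
  fixes t :: real
  assumes T: "card (L c) \<le> T" and t: "0 \<le> t" "t \<le> real k"
  shows "(\<Sum>u\<in>N v. \<Sum>w\<in>N u \<inter> L c. x w) \<le> (k - t) * n
    + t * card {u \<in> N v. card (N u \<inter> L c) \<le> k \<and> k - t < (\<Sum>w\<in>N u \<inter> L c. x w)}
    + real T * (2 ^ T * k)"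
    and "(\<Sum>u\<in>N v. \<Sum>w\<in>N u \<inter> L c. x w) \<le> k * card (N v) + real T * (2 ^ T * k)"
proof -
  let ?f = "\<lambda>u. \<Sum>w\<in>N u \<inter> L c. x w"
  let ?B = "{u. k < card (N u \<inter> L c)}"
  let ?G = "{u \<in> N v. card (N u \<inter> L c) \<le> k \<and> k - t < ?f u}"
  have "finite ?B"
  proof (rule finite_subset)
    show "?B \<subseteq> {..<n}"
    proof
      fix u assume "u \<in> ?B"
      then have "N u \<noteq> {}" by auto
      then show "u \<in> {..<n}" using E_lt by auto
    qed
  qed simp
  then have "card (N v \<inter> ?B) \<le> card ?B" by (intro card_mono) auto
  also have "\<dots> \<le> 2 ^ T * k" by (rule many_neighbours_le[OF finite_L T])
  finally have "real T * card (N v \<inter> ?B) \<le> real T * real (2 ^ T * k)"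
    by (intro mult_left_mono of_nat_mono) auto
  then have B: "real T * card (N v \<inter> ?B) \<le> real T * (2 ^ T * k)" by simp
  have fT: "?f u \<le> T" for u
  proof -
    have "card (N u \<inter> L c) \<le> card (L c)" by (intro card_mono) auto
    then have "real (card (N u \<inter> L c)) \<le> T" using T by simp
    then show ?thesis using sum_heavy_le_card[of u c] by linarith
  qed
  have "(\<Sum>u\<in>N v. ?f u) \<le> (\<Sum>u\<in>N v. (k - t) + ((if u \<in> ?G then t else 0) + (if u \<in> ?B then real T else 0)))"
  proof (intro sum_mono)
    fix u assume u: "u \<in> N v"
    show "?f u \<le> (k - t) + ((if u \<in> ?G then t else 0) + (if u \<in> ?B then real T else 0))"
    proof (cases "u \<in> ?B")
      case True
      then show ?thesis using fT[of u] t by auto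
    next
      case False
      then have "?f u \<le> k" using sum_heavy_le_card[of u c] by auto
      then show ?thesis using u False by auto
    qed
  qed
  also have "\<dots> = card (N v) * (k - t) + (t * card (N v \<inter> ?G) + real T * card (N v \<inter> ?B))"
    by (simp only: sum.distrib sum.If_cases[OF finite_N] sum.neutral_const sum_constant) (simp add: Int_def)
  also have "N v \<inter> ?G = ?G" by blast
  also have "card (N v) * (k - t) \<le> n * (k - t)" using card_N_le t by (intro mult_right_mono) auto
  finally show "(\<Sum>u\<in>N v. ?f u) \<le> (k - t) * n + t * card ?G + real T * (2 ^ T * k)"
    using B by (simp add: mult.commute)
  have "(\<Sum>u\<in>N v. ?f u) \<le> (\<Sum>u\<in>N v. real k + (if u \<in> ?B then real T else 0))"
  proof (intro sum_mono)
    fix u assume u: "u \<in> N v"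
    show "?f u \<le> real k + (if u \<in> ?B then real T else 0)"
    proof (cases "u \<in> ?B")
      case True
      then show ?thesis using fT[of u] t by auto
    next
      case False
      then show ?thesis using sum_heavy_le_card[of u c] by auto
    qed
  qed
  also have "\<dots> = card (N v) * k + real T * card (N v \<inter> ?B)"
    by (simp only: sum.distrib sum.If_cases[OF finite_N] sum.neutral_const sum_constant) (simp add: Int_def)
  finally show "(\<Sum>u\<in>N v. ?f u) \<le> k * card (N v) + real T * (2 ^ T * k)"
    using B by (simp add: mult.commute)
qed

text \<open>A good neighbour of \<open>z\<close> has exactly \<open>k\<close> heavy neighbours, of
  total weight above \<open>k - t\<close>, so each of these has entry above \<open>1 - t\<close>. As
  only \<open>k\<close> vertices have such entries, all good vertices see the same \<open>k\<close>
  vertices. The parameter \<open>e\<close> measures the error terms relative to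
  \<open>n\<close>.\<close>

lemma structure_from_bounds:
  assumes T: "card (L c) \<le> T" and c: "0 \<le> c" "c \<le> 1 / 2"
    and t: "t = 1 / (4 * (real k + 1))"
    and e: "c * (4 * k + 5) \<le> e" "e \<le> t" "real T * (2 ^ T * k) + (real k)\<^sup>2 \<le> e * n"
    and n: "2 * k < n" "2 * e < t"
  shows "\<exists>S\<subseteq>{..<n}. card S = k \<and> (\<forall>w\<in>S. 1 / 2 \<le> x w) \<and>
     (1 - 2 * e / t) * n \<le> card {u. \<forall>w\<in>S. E w u}"
proof -
  let ?f = "\<lambda>u. \<Sum>w\<in>N u \<inter> L c. x w"
  have tpos: "0 < t" "t \<le> 1 / 4" "t * (real k + 1) = 1 / 4" by (simp_all add: t field_simps)
  have kn2: "(k * n - (real k)\<^sup>2) * x v \<le> (\<Sum>u\<in>N v. ?f u) + e * n" if "v < n" for v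
  proof -
    have "(k * n - (real k)\<^sup>2) * x v \<le> l\<^sup>2 * x v"
      using l_sq x_nonneg by (intro mult_right_mono) (auto simp: algebra_simps power2_eq_square)
    also have "\<dots> \<le> (\<Sum>u\<in>N v. ?f u) + c * (4 * k + 5) * n" by (rule two_walk_heavy[OF that c(1)])
    also have "c * (4 * k + 5) * n \<le> e * n" using e(1) by (intro mult_right_mono) auto
    finally show ?thesis by simp
  qed
  have kx: "(real k)\<^sup>2 * x v \<le> (real k)\<^sup>2" for v using x_le_1[of v] x_nonneg[of v] by (simp add: mult_left_le)
  \<comment> \<open>An entry close to 1 forces almost full degree. The two errors
    \<open>e * n\<close> fit into \<open>k * e * n\<close> because \<open>k\<close> is at least
    2.\<close>
  have deg: "(x v - e) * n \<le> card (N v)" if "v < n" for v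
  proof -
    have tk: "t \<le> real k" using tpos k2 by simp
    have "k * n * x v \<le> k * card (N v) + 2 * e * n"
      using kn2[OF that] kx[of v] sum_heavy_bound(2)[OF T _ tk, of v] tpos e(3)
      by (simp add: algebra_simps)
    also have "\<dots> \<le> k * card (N v) + k * e * n"
    proof -
      have "0 \<le> e" using e(1) c(1) by (smt (verit) mult_nonneg_nonneg of_nat_0_le_iff)
      then show ?thesis using k2 by (intro add_left_mono mult_right_mono) auto
    qed
    finally have "k * (n * x v) \<le> k * (card (N v) + e * n)" by (simp add: algebra_simps)
    then have "n * x v \<le> card (N v) + e * n" using k2 by simp
    then show ?thesis by (simp add: algebra_simps)
  qed
  define G where "G = {u \<in> N z. card (N u \<inter> L c) \<le> k \<and> k - t < ?f u}"
  define S where "S = {w. w < n \<and> 1 - t < x w}"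
  have "k * real n - (real k)\<^sup>2 \<le> (\<Sum>u\<in>N z. ?f u) + e * n" using kn2[OF z_lt] x_z by simp
  also have "(\<Sum>u\<in>N z. ?f u) \<le> (k - t) * n + t * card G + real T * (2 ^ T * k)"
    unfolding G_def using tpos k2 by (intro sum_heavy_bound(1)[OF T]) auto
  finally have "t * n - 2 * e * n \<le> t * card G" using e(3) by (simp add: algebra_simps)
  then have "(t * n - 2 * e * n) / t \<le> card G" using tpos by (simp add: field_simps)
  then have cG: "(1 - 2 * e / t) * n \<le> card G" using tpos by (simp add: field_simps)
  have SL: "S \<subseteq> L c" using tpos c by (auto simp: S_def L_def)
  have GS: "k \<le> card (N u \<inter> S)" if u: "u \<in> G" for u
  proof -
    let ?A = "N u \<inter> L c"
    have cA: "card ?A \<le> k" and f: "k - t < ?f u" using u by (auto simp: G_def)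
    have "k - t < card ?A" using f sum_heavy_le_card[of u c] by linarith
    then have "real k < real (card ?A) + 1" using tpos by linarith
    then have "card ?A = k" using cA by linarith
    moreover have "?A \<subseteq> N u \<inter> S"
    proof
      fix w assume w: "w \<in> ?A"
      have "?f u = x w + (\<Sum>w\<in>?A - {w}. x w)" using w by (simp add: sum.remove)
      also have "(\<Sum>w\<in>?A - {w}. x w) \<le> (\<Sum>w\<in>?A - {w}. 1)" by (intro sum_mono x_le_1)
      also have "\<dots> \<le> real k - 1" using w cA k2 by (simp add: card_Diff_singleton of_nat_diff)
      finally have "1 - t < x w" using f by linarith
      then show "w \<in> N u \<inter> S" using w by (auto simp: S_def L_def)
    qed
    then have "card ?A \<le> card (N u \<inter> S)" by (intro card_mono) auto
    ultimately show ?thesis by simp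
  qed
  have finS: "finite S" using SL finite_L finite_subset by blast
  \<comment> \<open>Each vertex of \<open>S\<close> misses at most \<open>2 * t * n\<close> others.
    By the choice of \<open>t\<close>, any \<open>k + 1\<close> of them together miss at most half
    of all vertices, leaving too many common neighbours.\<close>
  have "card S \<le> k"
  proof (rule ccontr)
    assume "\<not> card S \<le> k"
    then have "Suc k \<le> card S" by simp
    then obtain S' where S': "S' \<subseteq> S" "card S' = Suc k" "finite S'" by (rule obtain_subset_with_card_n)
    let ?C = "{u. \<forall>s\<in>S'. E s u}"
    have "{..<n} \<subseteq> ?C \<union> (\<Union>s\<in>S'. {..<n} - N s)" by auto
    moreover have "?C \<subseteq> {..<n}"
    proof -
      obtain s where "s \<in> S'" using S'(2) by fastforce
      then show ?thesis using E_lt by blast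
    qed
    then have finC: "finite ?C" using finite_subset by blast
    ultimately have "card {..<n} \<le> card (?C \<union> (\<Union>s\<in>S'. {..<n} - N s))"
      using S'(3) by (intro card_mono) auto
    also have "\<dots> \<le> card ?C + card (\<Union>s\<in>S'. {..<n} - N s)" by (rule card_Un_le)
    also have "\<dots> \<le> k + (\<Sum>s\<in>S'. card ({..<n} - N s))"
      using S' by (intro add_mono common_neighbours_le card_UN_le) auto
    finally have "real n \<le> real k + (\<Sum>s\<in>S'. real (card ({..<n} - N s)))"
      by (metis card_lessThan of_nat_add of_nat_le_iff of_nat_sum)
    also have "(\<Sum>s\<in>S'. real (card ({..<n} - N s))) \<le> (\<Sum>s\<in>S'. 2 * t * n)"
    proof (intro sum_mono)
      fix s assume "s \<in> S'"
      then have s: "s < n" "1 - t < x s" using S'(1) by (auto simp: S_def)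
      have "(1 - 2 * t) * n \<le> (x s - e) * n" using s e(2) by (intro mult_right_mono) auto
      also have "\<dots> \<le> card (N s)" by (rule deg[OF s(1)])
      finally show "real (card ({..<n} - N s)) \<le> 2 * t * n"
        using N_subset[of s] card_N_le[of s] by (simp add: card_Diff_subset of_nat_diff algebra_simps)
    qed
    also have "\<dots> = 2 * (t * (real k + 1)) * n" using S'(2) by (simp add: algebra_simps)
    also have "\<dots> = n / 2" by (simp add: tpos(3))
    finally show False using n(1) by simp
  qed
  moreover have "G \<noteq> {}"
  proof
    assume "G = {}"
    then have "(1 - 2 * e / t) * n \<le> 0" using cG by simp
    moreover have "(1 - 2 * e / t) > 0" using n(2) tpos by (simp add: field_simps)
    ultimately show False using n(1) by (simp add: mult_le_0_iff)
  qed
  then obtain u0 where "u0 \<in> G" by blast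
  then have "k \<le> card (N u0 \<inter> S)" by (rule GS)
  then have "k \<le> card S" using card_mono[of S "N u0 \<inter> S"] finS by auto
  ultimately have cS: "card S = k" by simp
  have "G \<subseteq> {u. \<forall>w\<in>S. E w u}"
  proof
    fix u assume "u \<in> G"
    then have "card S \<le> card (N u \<inter> S)" using GS cS by simp
    then have "N u \<inter> S = S" using finS card_seteq[of S "N u \<inter> S"] by simp
    then have "S \<subseteq> N u" by blast
    then have "E w u" if "w \<in> S" for w using that E_sym[of w u] by auto
    then show "u \<in> {u. \<forall>w\<in>S. E w u}" by blast
  qed
  moreover have "finite {u. \<forall>w\<in>S. E w u}"
  proof -
    obtain s where "s \<in> S" using cS k2 by fastforce
    then have "{u. \<forall>w\<in>S. E w u} \<subseteq> N s" by auto
    then show ?thesis by (rule finite_subset) (rule finite_N)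
  qed
  ultimately have "card G \<le> card {u. \<forall>w\<in>S. E w u}" by (intro card_mono)
  then have "(1 - 2 * e / t) * n \<le> card {u. \<forall>w\<in>S. E w u}" using cG by linarith
  moreover have "S \<subseteq> {..<n}" by (auto simp: S_def)
  moreover have "\<forall>w\<in>S. 1 / 2 \<le> x w" using tpos by (auto simp: S_def)
  ultimately show ?thesis using cS by blast
qed

end

lemma dominating_set_exists:
  fixes d :: real
  assumes "0 < d" "d < 1"
  shows "\<forall>\<^sub>F n in sequentially. \<forall>E x l z. perron n k E x l z \<longrightarrow>
    (\<exists>S\<subseteq>{..<n}. card S = k \<and> (\<forall>w\<in>S. 1 / 2 \<le> x w) \<and> (1 - d) * n \<le> card {u. \<forall>w\<in>S. E w u})"
proof -
  define t where "t = 1 / (4 * (real k + 1))"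
  have t: "0 < t" "t \<le> 1" by (auto simp: t_def field_simps)
  \<comment> \<open>Makes the loss \<open>2 * e / t\<close> equal to the prescribed
    \<open>d\<close>.\<close>
  define e where "e = d * t / 2"
  have e: "0 < e" "e \<le> t" "2 * e < t" "2 * e / t = d"
    using assms t by (auto simp: e_def field_simps mult_less_cancel_right1)
  define c where "c = e / (4 * k + 5)"
  have c: "0 < c" "c * (4 * k + 5) \<le> e" using e by (auto simp: c_def)
  have "c \<le> e / 2" unfolding c_def using e by (intro divide_left_mono) auto
  then have c2: "c \<le> 1 / 2" using e t by simp
  obtain T where T: "\<forall>\<^sub>F n in sequentially. \<forall>E x l z. perron n k E x l z \<longrightarrow> card (perron.L n x c) \<le> T"
    using heavy_bounded[OF c(1)] by blast
  have e1: "\<forall>\<^sub>F n in sequentially. (real T * (2 ^ T * k) + (real k)\<^sup>2) / e + real (2 * k + 1) \<le> real n"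
    by (rule eventually_real_ge)
  from T e1 show ?thesis
  proof eventually_elim
    case (elim n)
    have n: "2 * k < n"
    proof -
      have "real (2 * k + 1) \<le> real n" using elim(2) e by (smt (verit) divide_nonneg_pos of_nat_0_le_iff zero_le_power zero_le_mult_iff)
      then show ?thesis by linarith
    qed
    have en: "real T * (2 ^ T * k) + (real k)\<^sup>2 \<le> e * n"
    proof -
      have "(real T * (2 ^ T * k) + (real k)\<^sup>2) / e \<le> real n" using elim(2) by simp
      then show ?thesis using e by (simp add: field_simps)
    qed
    show ?case
    proof (intro allI impI)
      fix E x l z assume "perron n k E x l z"
      then interpret perron n k E x l z .
      have "card (L c) \<le> T" using elim(1) perron_axioms by blast
      from structure_from_bounds[OF this _ c2 t_def c(2) e(2) en n e(3)] c(1) e(4)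
      show "\<exists>S\<subseteq>{..<n}. card S = k \<and> (\<forall>w\<in>S. 1 / 2 \<le> x w) \<and> (1 - d) * n \<le> card {u. \<forall>w\<in>S. E w u}"
        by simp
    qed
  qed
qed

section \<open>Around k vertices with many common neighbours\<close>

text \<open>The slack in \<open>many_common\<close> lets paths alternating between \<open>S\<close>
  and its common neighbours avoid up to four prescribed vertices.\<close>

locale dominated = cycle_free +
  fixes S :: "nat set"
  assumes S_subset: "S \<subseteq> {..<n}" and card_S: "card S = k"
    and many_common: "2 * k + 4 \<le> card {u. \<forall>w\<in>S. E w u}"
begin

definition R :: "nat set" where "R = {u. \<forall>w\<in>S. E w u}"
definition W :: "nat set" where "W = {..<n} - S - R"

lemma finite_S [simp]: "finite S" using S_subset finite_subset by blast
lemma S_nonempty: "S \<noteq> {}" using card_S k2 by auto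
lemma S_R: "w \<in> S \<Longrightarrow> u \<in> R \<Longrightarrow> E w u" by (simp add: R_def)
lemma R_S: "w \<in> S \<Longrightarrow> u \<in> R \<Longrightarrow> E u w" using S_R E_sym[of u w] by simp
lemma R_subset: "R \<subseteq> {..<n}"
proof -
  obtain w where "w \<in> S" using S_nonempty by blast
  then show ?thesis using S_R E_lt by blast
qed
lemma finite_R [simp]: "finite R" using R_subset finite_subset by blast
lemma finite_W [simp]: "finite W" by (simp add: W_def)
lemma W_subset: "W \<subseteq> {..<n}" by (auto simp: W_def)
lemma disjoint_SRW: "S \<inter> R = {}" "S \<inter> W = {}" "R \<inter> W = {}"
  using S_R E_irrefl unfolding W_def by blast+
lemma vertices_SRW: "{..<n} = S \<union> R \<union> W"
  using S_subset R_subset by (auto simp: W_def)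

lemma free_list_in_R:
  assumes "finite F" "card F \<le> 4" "m \<le> k"
  obtains ys where "length ys = m" "distinct ys" "set ys \<subseteq> R" "set ys \<inter> F = {}"
proof -
  have "card R - card F \<le> card (R - F)" using assms(1) by (rule diff_card_le_card_Diff)
  then have "m \<le> card (R - F)" using many_common assms(2,3) unfolding R_def[symmetric] by linarith
  then obtain T where T: "T \<subseteq> R - F" "card T = m" "finite T" by (rule obtain_subset_with_card_n)
  obtain ys where ys: "set ys = T" "distinct ys" using finite_distinct_list[OF T(3)] by blast
  have "length ys = m" using ys T(2) distinct_card[of ys] by simp
  then show thesis using that[of ys] ys T(1) by blast
qed

text \<open>An alternating path through all of \<open>S\<close> and \<open>k\<close> vertices of
  \<open>R\<close>, ending in \<open>a\<close>, continues by \<open>b\<close> and \<open>c\<close>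
  and closes up, since \<open>c\<close> is adjacent to all of \<open>S\<close>. The middle vertex
  may lie in \<open>R\<close> or in \<open>W\<close>, so this restricts both the edges inside
  \<open>R\<close> and those from \<open>W\<close> to \<open>R\<close>.\<close>

lemma no_path_between_R:
  assumes "a \<in> R" "c \<in> R" "a \<noteq> c" "b \<notin> S" "E a b" "E b c"
  shows False
proof -
  obtain xs where xs: "set xs = S" "distinct xs" using finite_distinct_list[OF finite_S] by blast
  have lx: "length xs = k" using xs card_S distinct_card[of xs] by simp
  have "card {a, b, c} \<le> 4" by (simp add: card_insert_if)
  then obtain ys where ys: "length ys = k - 1" "distinct ys" "set ys \<subseteq> R" "set ys \<inter> {a, b, c} = {}"
    using free_list_in_R[of "{a, b, c}" "k - 1"] by auto
  have ne: "xs \<noteq> []" using lx k2 by auto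
  have len: "length xs = length (ys @ [a])" using lx ys(1) k2 by simp
  have d: "distinct (ys @ [a])" using ys by auto
  have sub: "set (ys @ [a]) \<subseteq> R" using ys assms by auto
  then have dis: "set xs \<inter> set (ys @ [a]) = {}" using disjoint_SRW(1) xs(1) by blast
  have adj: "E u v \<and> E v u" if "u \<in> set xs" "v \<in> set (ys @ [a])" for u v
    using that sub xs(1) S_R R_S by blast
  note p = splice_path[OF len xs(2) d dis ne adj]
  let ?p = "splice xs (ys @ [a])"
  have pne: "?p \<noteq> []" using ne by simp
  have bc: "b \<noteq> a" "c \<noteq> b" using assms(5,6) by auto
  have "c \<notin> S" using assms(2) disjoint_SRW(1) by blast
  then have "distinct (?p @ [b, c])" using p(1,3) ys(4) assms(3,4) bc xs(1) by auto
  moreover have "successively E (?p @ [b, c])"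
    using p(2,5) pne assms(5,6) by (simp add: successively_append_iff)
  moreover have "length (?p @ [b, c]) = 2 * k + 2" using lx ys(1) k2 by simp
  moreover have "hd (?p @ [b, c]) = hd xs" using p(4) pne by simp
  moreover have "E c (hd xs)" using assms(2) ne xs(1) R_S by auto
  ultimately show False using no_cycle[of "?p @ [b, c]"] by simp
qed

text \<open>One vertex \<open>s\<close> of \<open>S\<close> is kept back as a bridge. The
  alternating path through the other \<open>k - 1\<close> ends in \<open>c\<close> and goes on with
  \<open>d\<close>, \<open>s\<close>, \<open>a\<close>, \<open>b\<close>, giving 2(k - 1) + 4
  vertices.\<close>

lemma no_disjoint_edges_in_R:
  assumes "{a, b, c, d} \<subseteq> R" "a \<noteq> c" "a \<noteq> d" "b \<noteq> c" "b \<noteq> d" "E a b" "E c d"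
  shows False
proof -
  obtain xs' where xs': "set xs' = S" "distinct xs'" using finite_distinct_list[OF finite_S] by blast
  have "length xs' = k" using xs' card_S distinct_card[of xs'] by simp
  then obtain s xs where s: "xs' = s # xs" using k2 by (cases xs') auto
  have lx: "length xs = k - 1" using s \<open>length xs' = k\<close> by simp
  have xs: "set xs \<subseteq> S" "s \<in> S" "distinct xs" "s \<notin> set xs" using xs' s by auto
  have "card {a, b, c, d} \<le> 4" by (simp add: card_insert_if)
  then obtain ys where ys: "length ys = k - 2" "distinct ys" "set ys \<subseteq> R" "set ys \<inter> {a, b, c, d} = {}"
    using free_list_in_R[of "{a, b, c, d}" "k - 2"] by auto
  have ne: "xs \<noteq> []" using lx k2 by auto
  have len: "length xs = length (ys @ [c])" using lx ys(1) k2 by simp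
  have dy: "distinct (ys @ [c])" using ys by auto
  have sub: "set (ys @ [c]) \<subseteq> R" using ys assms by auto
  then have dis: "set xs \<inter> set (ys @ [c]) = {}" using disjoint_SRW(1) xs(1) by blast
  have adj: "E u v \<and> E v u" if "u \<in> set xs" "v \<in> set (ys @ [c])" for u v
    using that sub xs(1) S_R R_S by blast
  note p = splice_path[OF len xs(3) dy dis ne adj]
  let ?p = "splice xs (ys @ [c])"
  have pne: "?p \<noteq> []" using ne by simp
  have RS: "a \<notin> S" "b \<notin> S" "d \<notin> S" "s \<notin> R" using assms(1) xs(2) disjoint_SRW(1) by auto
  have ne2: "a \<noteq> b" "c \<noteq> d" using assms(6,7) by auto
  have "distinct (?p @ [d, s, a, b])"
  proof -
    have "set ?p \<inter> {d, s, a, b} = {}"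
      using p(3) ys(3,4) xs RS assms(1-5) ne2 by auto
    moreover have "distinct [d, s, a, b]" using RS assms(1-5) ne2 xs(2) by auto
    ultimately show ?thesis using p(1) by simp
  qed
  moreover have "successively E (?p @ [d, s, a, b])"
    using p(2,5) pne assms xs(2) S_R[of s a] R_S[of s d] by (simp add: successively_append_iff)
  moreover have "length (?p @ [d, s, a, b]) = 2 * k + 2" using lx ys(1) k2 by simp
  moreover have "hd (?p @ [d, s, a, b]) = hd xs" using p(4) pne by simp
  moreover have "E b (hd xs)" using assms(1) ne xs(1) R_S hd_in_set[OF ne] by blast
  ultimately show False using no_cycle[of "?p @ [d, s, a, b]"] by simp
qed

lemma card_N_R_le_1:
  assumes "v \<notin> S"
  shows "card (N v \<inter> R) \<le> 1"
proof (rule ccontr)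
  assume "\<not> ?thesis"
  then have "\<not> card (N v \<inter> R) \<le> Suc 0" by simp
  then obtain a c where "a \<in> N v \<inter> R" "c \<in> N v \<inter> R" "a \<noteq> c"
    using card_le_Suc0_iff_eq[OF finite_Int[of "N v" R]] finite_N by blast
  then show False using no_path_between_R[of a c v] assms E_sym[of a v] by simp
qed

lemma at_most_one_edge_in_R:
  obtains a b where "a \<in> R" "b \<in> R" "a \<noteq> b"
    "\<forall>u\<in>R. \<forall>v\<in>R. E u v \<longrightarrow> {u, v} = {a, b}"
proof (cases "\<exists>a\<in>R. \<exists>b\<in>R. E a b")
  case True
  then obtain a b where ab: "a \<in> R" "b \<in> R" "E a b" by blast
  have nS: "a \<notin> S" "b \<notin> S" using ab disjoint_SRW by auto
  have "{u, v} = {a, b}" if uv: "u \<in> R" "v \<in> R" "E u v" for u v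
  proof -
    have path: "y = w" if "y \<in> R" "w \<in> R" "m \<in> {a, b}" "E y m" "E m w" for y m w
      using no_path_between_R[of y w m] that nS by blast
    have sym: "E b a" "E v u" using ab uv E_sym by auto
    have "u \<in> {a, b} \<or> v \<in> {a, b}"
      using no_disjoint_edges_in_R[of a b u v] ab uv by blast
    then consider "u = a" | "u = b" | "v = a" | "v = b" by blast
    then show ?thesis
    proof cases
      case 1 then show ?thesis using path[of b v a] ab uv sym by auto
    next
      case 2 then show ?thesis using path[of a v b] ab uv sym by auto
    next
      case 3 then show ?thesis using path[of b u a] ab uv sym by auto
    next
      case 4 then show ?thesis using path[of a u b] ab uv sym by auto
    qed
  qed
  then have all: "\<forall>u\<in>R. \<forall>v\<in>R. E u v \<longrightarrow> {u, v} = {a, b}" by blast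
  have "a \<noteq> b" using ab by auto
  then show thesis by (rule that[OF ab(1,2) _ all])
next
  case False
  \<comment> \<open>Without an edge in \<open>R\<close> any two of its vertices serve: the candidate
    needs a place for its extra edge.\<close>
  have "\<not> card R \<le> Suc 0" using many_common by (simp add: R_def)
  then obtain a b where "a \<in> R" "b \<in> R" "a \<noteq> b" using card_le_Suc0_iff_eq[of R] by auto
  moreover have "\<forall>u\<in>R. \<forall>v\<in>R. E u v \<longrightarrow> {u, v} = {a, b}" using False by blast
  ultimately show thesis by (rule that)
qed

lemma sum_N_SRW:
  fixes f :: "nat \<Rightarrow> real"
  shows "(\<Sum>j\<in>N i. f j) = (\<Sum>j\<in>N i \<inter> S. f j) + (\<Sum>j\<in>N i \<inter> R. f j) + (\<Sum>j\<in>N i \<inter> W. f j)"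
proof -
  have "N i = (N i \<inter> S \<union> N i \<inter> R) \<union> N i \<inter> W" using N_subset[of i] vertices_SRW by blast
  then have "(\<Sum>j\<in>N i. f j) = (\<Sum>j\<in>(N i \<inter> S \<union> N i \<inter> R) \<union> N i \<inter> W. f j)" by simp
  also have "\<dots> = (\<Sum>j\<in>N i \<inter> S \<union> N i \<inter> R. f j) + (\<Sum>j\<in>N i \<inter> W. f j)"
    using disjoint_SRW by (intro sum.union_disjoint) auto
  also have "(\<Sum>j\<in>N i \<inter> S \<union> N i \<inter> R. f j) = (\<Sum>j\<in>N i \<inter> S. f j) + (\<Sum>j\<in>N i \<inter> R. f j)"
    using disjoint_SRW by (intro sum.union_disjoint) auto
  finally show ?thesis .
qed

lemma sum_N_swap:
  fixes f :: "nat \<Rightarrow> nat \<Rightarrow> real"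
  assumes "finite A" "finite B"
  shows "(\<Sum>a\<in>A. \<Sum>b\<in>N a \<inter> B. f a b) = (\<Sum>b\<in>B. \<Sum>a\<in>N b \<inter> A. f a b)"
proof -
  have "N a \<inter> B = {b \<in> B. E a b}" for a by auto
  moreover have "N b \<inter> A = {a \<in> A. E a b}" for b
    by (intro set_eqI) (simp add: E_sym[of _ b] conj_commute)
  ultimately show ?thesis by (simp only: sum.swap_restrict[OF assms, of f E])
qed

end

context cycle_free
begin

text \<open>Applying the walk bound to the induced graph replaces \<open>n\<close> by
  \<open>card U\<close>, which matters because it is applied to the small set
  \<open>W\<close>.\<close>

lemma restricted_two_walks_le:
  assumes "U \<subseteq> {..<n}" "v \<in> U"
  shows "(\<Sum>u\<in>N v \<inter> U. card (N u \<inter> U)) \<le> (4 * k + 5) * card U"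
proof -
  interpret H: cycle_free n k "\<lambda>i j. E i j \<and> i \<in> U \<and> j \<in> U" by (rule restrict_cycle_free)
  have HN: "H.N w = N w \<inter> U" if "w \<in> U" for w using that by (auto simp: H.in_N set_eq_iff)
  have finU: "finite U" using assms(1) finite_subset by blast
  have "(\<Sum>u\<in>N v \<inter> U. card (N u \<inter> U)) = (\<Sum>u\<in>H.N v. card (H.N u \<inter> U))"
    by (intro sum.cong) (auto simp: HN assms(2))
  also have "\<dots> \<le> (2 * k + 2) * (card (H.N v) + card U) + card (H.N v)"
    by (rule H.two_walks_le_all[OF assms(1)])
  also have "\<dots> \<le> (2 * k + 2) * (card U + card U) + card U"
  proof -
    have "card (H.N v) \<le> card U" using HN[OF assms(2)] finU by (simp add: card_mono)
    then show ?thesis by (intro add_mono mult_le_mono2) auto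
  qed
  finally show ?thesis by (simp add: algebra_simps)
qed

end

lemma sum_squared_le_card:
  fixes f :: "'a \<Rightarrow> real"
  assumes "finite A"
  shows "(\<Sum>a\<in>A. f a)\<^sup>2 \<le> card A * (\<Sum>a\<in>A. (f a)\<^sup>2)"
  using Cauchy_Schwarz_ineq_sum[of "\<lambda>_. 1" f A] by simp

context dominated
begin

text \<open>The square of the adjacency matrix of the graph on \<open>W\<close> has row sums at most
  \<open>(4 * k + 5) * card W\<close>, the number of two-walks inside \<open>W\<close>; the square
  root bounds its quadratic form. Cauchy-Schwarz is applied once for each row and once for the whole
  form.\<close>

lemma quad_W_le:
  fixes f :: "nat \<Rightarrow> real"
  shows "(\<Sum>w\<in>W. f w * (\<Sum>u\<in>N w \<inter> W. f u)) \<le> sqrt ((4 * k + 5) * card W) * (\<Sum>w\<in>W. (f w)\<^sup>2)"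
proof -
  let ?M = "real ((4 * k + 5) * card W)" and ?q = "\<Sum>w\<in>W. (f w)\<^sup>2"
  have q: "?q \<ge> 0" by (intro sum_nonneg) auto
  have "(\<Sum>w\<in>W. (\<Sum>u\<in>N w \<inter> W. f u)\<^sup>2) \<le> (\<Sum>w\<in>W. card (N w \<inter> W) * (\<Sum>u\<in>N w \<inter> W. (f u)\<^sup>2))"
    by (intro sum_mono sum_squared_le_card) auto
  also have "\<dots> = (\<Sum>w\<in>W. \<Sum>u\<in>N w \<inter> W. card (N w \<inter> W) * (f u)\<^sup>2)" by (simp add: sum_distrib_left)
  also have "\<dots> = (\<Sum>u\<in>W. \<Sum>w\<in>N u \<inter> W. card (N w \<inter> W) * (f u)\<^sup>2)" by (rule sum_N_swap) auto
  also have "\<dots> = (\<Sum>u\<in>W. real (\<Sum>w\<in>N u \<inter> W. card (N w \<inter> W)) * (f u)\<^sup>2)" by (simp add: sum_distrib_right)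
  also have "\<dots> \<le> (\<Sum>u\<in>W. ?M * (f u)\<^sup>2)"
    using restricted_two_walks_le[OF W_subset] by (intro sum_mono mult_right_mono of_nat_mono) auto
  also have "\<dots> = ?M * ?q" by (simp add: sum_distrib_left)
  finally have y: "(\<Sum>w\<in>W. (\<Sum>u\<in>N w \<inter> W. f u)\<^sup>2) \<le> ?M * ?q" .
  have "(\<Sum>w\<in>W. f w * (\<Sum>u\<in>N w \<inter> W. f u))\<^sup>2 \<le> ?q * (\<Sum>w\<in>W. (\<Sum>u\<in>N w \<inter> W. f u)\<^sup>2)"
    by (rule Cauchy_Schwarz_ineq_sum)
  also have "\<dots> \<le> ?q * (?M * ?q)" using y q by (rule mult_left_mono)
  also have "\<dots> = (sqrt ?M * ?q)\<^sup>2" by (simp add: power_mult_distrib power2_eq_square)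
  finally show ?thesis by (rule power2_le_imp_le) (use q in simp)
qed

end

section \<open>Comparison with the candidate\<close>

text \<open>The candidate placed on the vertices of the given graph, so that \<open>x\<close> can
  serve as its test vector without relabelling.\<close>

definition join_plus :: "nat \<Rightarrow> nat set \<Rightarrow> nat \<Rightarrow> nat \<Rightarrow> nat \<Rightarrow> nat \<Rightarrow> bool" where
  "join_plus n S a b i j \<longleftrightarrow> i < n \<and> j < n \<and> i \<noteq> j \<and> (i \<in> S \<or> j \<in> S \<or> {i, j} = {a, b})"

lemma is_graph_join_plus: "is_graph n (join_plus n S a b)"
  by (auto simp: is_graph_def join_plus_def insert_commute)

lemma join_plus_iso_S_plus:
  assumes "S \<subseteq> {..<n}" "card S = k" "a \<in> {..<n} - S" "b \<in> {..<n} - S" "a \<noteq> b"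
  shows "graph_iso n (join_plus n S a b) (S_plus n k)"
proof -
  have finS: "finite S" using assms(1) finite_subset by blast
  let ?T = "{..<n} - S - {a, b}"
  have n: "n = k + 2 + card ?T"
  proof -
    have "card ({..<n} - S) = n - k" using assms(1,2) finS by (simp add: card_Diff_subset)
    moreover have "card ({..<n} - S - {a, b}) = card ({..<n} - S) - 2"
      using assms(3-5) by (subst card_Diff_subset) auto
    moreover have "card {a, b} \<le> card ({..<n} - S)" using assms(3,4) by (intro card_mono) auto
    moreover have "k \<le> n" using card_mono[OF _ assms(1)] assms(2) by simp
    ultimately show ?thesis using assms(5) by simp
  qed
  have "card S = card {0..<k}" using assms(2) by simp
  then obtain g where g: "bij_betw g S {0..<k}"
    using finite_same_card_bij[OF finS] by blast
  have "card ?T = card {k + 2..<n}" using n by simp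
  then obtain h where h: "bij_betw h ?T {k + 2..<n}"
    using finite_same_card_bij[of ?T "{k + 2..<n}"] by blast
  define f where "f i = (if i \<in> S then g i else if i = a then k else if i = b then k + 1 else h i)" for i
  have f1: "bij_betw f S {0..<k}"
    using g by (rule bij_betw_cong[THEN iffD1, rotated]) (simp add: f_def)
  have f2: "bij_betw f {a, b} {k, k + 1}"
    using assms(3-5) by (auto simp: bij_betw_def inj_on_def f_def)
  have f3: "bij_betw f ?T {k + 2..<n}"
    using h by (rule bij_betw_cong[THEN iffD1, rotated]) (auto simp: f_def)
  have "bij_betw f (S \<union> {a, b}) ({0..<k} \<union> {k, k + 1})"
    by (rule bij_betw_combine[OF f1 f2]) auto
  then have "bij_betw f ((S \<union> {a, b}) \<union> ?T) (({0..<k} \<union> {k, k + 1}) \<union> {k + 2..<n})"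
    by (rule bij_betw_combine[OF _ f3]) auto
  moreover have "(S \<union> {a, b}) \<union> ?T = {0..<n}" using assms(1,3,4) by auto
  moreover have "({0..<k} \<union> {k, k + 1}) \<union> {k + 2..<n} = {0..<n}" using n by auto
  ultimately have f: "bij_betw f {0..<n} {0..<n}" by simp
  have in_S: "f i < k \<longleftrightarrow> i \<in> S" if i: "i < n" for i
  proof
    assume "i \<in> S" then show "f i < k" using bij_betwE[OF f1] by auto
  next
    assume *: "f i < k"
    show "i \<in> S"
    proof (rule ccontr)
      assume "i \<notin> S"
      then consider "i \<in> {a, b}" | "i \<in> ?T" using i by blast
      then show False
      proof cases
        case 1 then show False using * \<open>i \<notin> S\<close> by (auto simp: f_def split: if_splits)
      next
        case 2 then have "f i \<in> {k + 2..<n}" using bij_betwE[OF f3] by blast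
        then show False using * by simp
      qed
    qed
  qed
  have inj: "inj_on f {..<n}" using f by (simp add: bij_betw_def lessThan_atLeast0)
  have fab: "f a = k" "f b = k + 1" using assms(3-5) by (auto simp: f_def)
  have "join_plus n S a b i j \<longleftrightarrow> S_plus n k (f i) (f j)" if ij: "i < n" "j < n" for i j
  proof -
    have fn: "f i < n" "f j < n" using bij_betwE[OF f] ij by auto
    have eq: "f u = f v \<longleftrightarrow> u = v" if "u < n" "v < n" for u v
      using inj_on_eq_iff[OF inj, of u v] that by simp
    have "{f i, f j} = {k, k + 1} \<longleftrightarrow> {i, j} = {a, b}"
      using inj_on_image_eq_iff[OF inj, of "{i, j}" "{a, b}"] fab ij assms(3,4) by simp
    then show ?thesis using fn ij in_S eq by (simp add: join_plus_def S_plus_def)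
  qed
  then show ?thesis using f unfolding graph_iso_def by blast
qed

section \<open>Weight at the exceptional set and the final comparison\<close>

locale dominated_perron = perron n k E x l z + dominated n k E S
  for n k E x l z S +
  assumes half: "w \<in> S \<Longrightarrow> 1 / 2 \<le> x w" and l_pos: "0 < l"
begin

abbreviation s where "s \<equiv> (\<Sum>w\<in>W. x w)"
abbreviation q where "q \<equiv> (\<Sum>w\<in>W. (x w)\<^sup>2)"
abbreviation quadW where "quadW \<equiv> (\<Sum>w\<in>W. x w * (\<Sum>u\<in>N w \<inter> W. x u))"
abbreviation quadWR where "quadWR \<equiv> (\<Sum>w\<in>W. x w * (\<Sum>u\<in>N w \<inter> R. x u))"

lemma s_nonneg: "0 \<le> s" by (intro sum_nonneg x_nonneg)

lemma sum_S_le: "(\<Sum>u\<in>N v \<inter> S. x u) \<le> k"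
proof -
  have "(\<Sum>u\<in>N v \<inter> S. x u) \<le> (\<Sum>u\<in>S. 1)"
    using x_le_1 by (intro order_trans[OF sum_mono2[of S "N v \<inter> S" x] sum_mono]) (auto simp: x_nonneg)
  then show ?thesis using card_S by simp
qed

lemma sum_R_le_1:
  assumes "v \<notin> S"
  shows "(\<Sum>u\<in>N v \<inter> R. x u) \<le> 1"
proof -
  have "(\<Sum>u\<in>N v \<inter> R. x u) \<le> (\<Sum>u\<in>N v \<inter> R. 1)" by (intro sum_mono x_le_1)
  then show ?thesis using card_N_R_le_1[OF assms] by simp
qed

lemma eig_bound:
  assumes "v < n" "v \<notin> S"
  shows "l * x v \<le> real k + 1 + (\<Sum>u\<in>N v \<inter> W. x u)"
  using eig[OF assms(1)] sum_N_SRW[of x v] sum_S_le[of v] sum_R_le_1[OF assms(2)] by simp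

text \<open>The left-hand side is the total weight of the edges absent from the candidate graph.\<close>

lemma outside_weight_small:
  assumes th: "0 \<le> th" "th \<le> 1 / 2" "sqrt ((4 * k + 5) * card W) \<le> th * l"
    and d: "card W \<le> d * l\<^sup>2" and small: "(real k + 1) * (2 / l + 4 * d + 2 * th) \<le> 1 / 4"
  shows "2 * quadWR + quadW \<le> s / 4"
proof -
  have q0: "0 \<le> q" by (intro sum_nonneg) auto
  have QW: "quadW \<le> th * l * q"
    using quad_W_le[of x] mult_right_mono[OF th(3) q0] by simp
  \<comment> \<open>Pairing the eigenvalue equation with \<open>x\<close> on \<open>W\<close> bounds
    \<open>l * q\<close> by a multiple of \<open>s\<close>; \<open>quadW\<close> reappears on the
    right and is absorbed because \<open>th \<le> 1 / 2\<close>.\<close>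
  have "l * q = (\<Sum>w\<in>W. x w * (l * x w))" by (simp add: sum_distrib_left power2_eq_square mult_ac)
  also have "\<dots> \<le> (\<Sum>w\<in>W. x w * (real k + 1 + (\<Sum>u\<in>N w \<inter> W. x u)))"
    using eig_bound W_subset disjoint_SRW by (intro sum_mono mult_left_mono x_nonneg) auto
  also have "\<dots> = (real k + 1) * s + quadW"
    by (simp add: distrib_left sum.distrib sum_distrib_left mult_ac)
  finally have "l * q \<le> (real k + 1) * s + th * (l * q)" using QW by simp
  moreover have "th * (l * q) \<le> 1 / 2 * (l * q)" using th(2) q0 l_pos by (intro mult_right_mono) auto
  ultimately have lq: "l * q \<le> 2 * (real k + 1) * s" unfolding mult.assoc by linarith
  have QW2: "quadW \<le> th * (2 * (real k + 1) * s)"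
    using QW mult_left_mono[OF lq th(1)] by (simp add: mult.assoc)
  let ?t = "\<lambda>r. \<Sum>w\<in>N r \<inter> W. x w"
  have WR: "quadWR = (\<Sum>r\<in>R. x r * ?t r)"
  proof -
    have "quadWR = (\<Sum>w\<in>W. \<Sum>u\<in>N w \<inter> R. x w * x u)" by (simp add: sum_distrib_left)
    also have "\<dots> = (\<Sum>u\<in>R. \<Sum>w\<in>N u \<inter> W. x w * x u)" by (rule sum_N_swap) auto
    finally show ?thesis by (simp add: sum_distrib_left mult.commute)
  qed
  have cR: "real (card (N w \<inter> R)) \<le> 1" if "w \<in> W" for w
    using card_N_R_le_1[of w] that disjoint_SRW(2) by auto
  have t1: "(\<Sum>r\<in>R. ?t r) \<le> s"
  proof -
    have "(\<Sum>r\<in>R. ?t r) = (\<Sum>w\<in>W. \<Sum>r\<in>N w \<inter> R. x w)" by (rule sum_N_swap) auto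
    also have "\<dots> = (\<Sum>w\<in>W. card (N w \<inter> R) * x w)" by simp
    also have "\<dots> \<le> (\<Sum>w\<in>W. 1 * x w)" using cR by (intro sum_mono mult_right_mono x_nonneg) auto
    finally show ?thesis by simp
  qed
  have t2: "(\<Sum>r\<in>R. (?t r)\<^sup>2) \<le> card W * q"
  proof -
    have "(\<Sum>r\<in>R. (?t r)\<^sup>2) \<le> (\<Sum>r\<in>R. card W * (\<Sum>w\<in>N r \<inter> W. (x w)\<^sup>2))"
    proof (intro sum_mono)
      fix r
      have "(?t r)\<^sup>2 \<le> card (N r \<inter> W) * (\<Sum>w\<in>N r \<inter> W. (x w)\<^sup>2)" by (rule sum_squared_le_card) auto
      also have "\<dots> \<le> card W * (\<Sum>w\<in>N r \<inter> W. (x w)\<^sup>2)"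
        by (intro mult_right_mono sum_nonneg of_nat_mono card_mono) auto
      finally show "(?t r)\<^sup>2 \<le> card W * (\<Sum>w\<in>N r \<inter> W. (x w)\<^sup>2)" .
    qed
    also have "\<dots> = card W * (\<Sum>r\<in>R. \<Sum>w\<in>N r \<inter> W. (x w)\<^sup>2)" by (simp add: sum_distrib_left)
    also have "(\<Sum>r\<in>R. \<Sum>w\<in>N r \<inter> W. (x w)\<^sup>2) = (\<Sum>w\<in>W. \<Sum>r\<in>N w \<inter> R. (x w)\<^sup>2)"
      by (rule sum_N_swap) auto
    also have "\<dots> = (\<Sum>w\<in>W. card (N w \<inter> R) * (x w)\<^sup>2)" by simp
    also have "\<dots> \<le> (\<Sum>w\<in>W. 1 * (x w)\<^sup>2)" using cR by (intro sum_mono mult_right_mono) auto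
    finally show ?thesis by (simp add: mult_left_mono)
  qed
  \<comment> \<open>Here \<open>x r \<le> 1\<close> would only give \<open>quadWR \<le> s\<close>,
    too weak for the goal. Multiplying by \<open>l\<close> brings in the eigenvalue equation at
    \<open>r\<close>; the resulting squares are controlled by \<open>t2\<close> and the smallness of
    \<open>W\<close>.\<close>
  have "l * quadWR = (\<Sum>r\<in>R. (l * x r) * ?t r)" unfolding WR by (simp add: sum_distrib_left mult.assoc)
  also have "\<dots> \<le> (\<Sum>r\<in>R. (real k + 1 + ?t r) * ?t r)"
  proof (intro sum_mono mult_right_mono sum_nonneg x_nonneg)
    fix r assume r: "r \<in> R"
    then have "r < n" "r \<notin> S" using R_subset disjoint_SRW by auto
    then show "l * x r \<le> real k + 1 + ?t r" by (rule eig_bound)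
  qed
  also have "\<dots> = (real k + 1) * (\<Sum>r\<in>R. ?t r) + (\<Sum>r\<in>R. (?t r)\<^sup>2)"
    by (simp add: distrib_right sum.distrib sum_distrib_left power2_eq_square)
  also have "\<dots> \<le> (real k + 1) * s + card W * q"
    using t1 t2 by (intro add_mono mult_left_mono) auto
  also have "card W * q \<le> d * l\<^sup>2 * q" using d q0 by (rule mult_right_mono)
  also have "d * l\<^sup>2 * q = d * l * (l * q)" by (simp add: power2_eq_square)
  also have "\<dots> \<le> d * l * (2 * (real k + 1) * s)"
  proof -
    have "0 \<le> d * l\<^sup>2" using d by (meson of_nat_0_le_iff order_trans)
    then have "0 \<le> d * l" using l_pos by (simp add: zero_le_mult_iff)
    then show ?thesis using lq by (intro mult_left_mono) auto
  qed
  also have "(real k + 1) * s + d * l * (2 * (real k + 1) * s) = l * ((real k + 1) * s * (1 / l + 2 * d))"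
    using l_pos by (simp add: field_simps)
  finally have "l * quadWR \<le> l * ((real k + 1) * s * (1 / l + 2 * d))" by simp
  then have P: "quadWR \<le> (real k + 1) * s * (1 / l + 2 * d)" using l_pos by simp
  have "2 * quadWR + quadW \<le> 2 * ((real k + 1) * s * (1 / l + 2 * d)) + th * (2 * (real k + 1) * s)"
    using P QW2 by simp
  also have "\<dots> = ((real k + 1) * (2 / l + 4 * d + 2 * th)) * s" by (simp add: algebra_simps add_divide_distrib)
  also have "\<dots> \<le> 1 / 4 * s" using small s_nonneg by (rule mult_right_mono)
  finally show ?thesis by simp
qed

lemma iso_S_plus:
  assumes small: "2 * quadWR + quadW \<le> s / 4"
    and sr: "spectral_radius n (S_plus n k) \<le> l"
  shows "graph_iso n E (S_plus n k)"
proof -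
  obtain a b where ab: "a \<in> R" "b \<in> R" "a \<noteq> b"
    and edge: "\<forall>u\<in>R. \<forall>v\<in>R. E u v \<longrightarrow> {u, v} = {a, b}"
    by (rule at_most_one_edge_in_R)
  have abn: "a \<in> {..<n} - S" "b \<in> {..<n} - S" using ab R_subset disjoint_SRW by auto
  define F where "F = join_plus n S a b"
  have F_graph: "is_graph n F" unfolding F_def by (rule is_graph_join_plus)
  have iso: "graph_iso n F (S_plus n k)"
    unfolding F_def by (rule join_plus_iso_S_plus[OF S_subset card_S abn ab(3)])
  let ?lF = "spectral_radius n F"
  have lF: "?lF \<le> l" using sr spectral_radius_iso[OF iso] by simp
  define NF where "NF i = {j. j < n \<and> F i j}" for i
  have finNF: "finite (NF i)" for i by (simp add: NF_def)
  have AF: "adj_mult n F x i = (\<Sum>j\<in>NF i. x j)" for i by (simp add: adj_mult_eq_sum NF_def)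
  have quadF: "quad n F x = (\<Sum>i<n. x i * (\<Sum>j\<in>NF i. x j))" by (simp add: quad_def AF)
  have n1: "n \<ge> 1" using z_lt by simp
  have rowS: "N i \<subseteq> NF i" if "i \<in> S" for i
    using that S_subset E_lt[of i] by (auto simp: NF_def F_def join_plus_def)
  have rowR: "N i - W \<subseteq> NF i" if "i \<in> R" for i
  proof
    fix j assume j: "j \<in> N i - W"
    then have jn: "j < n" "i < n" "i \<noteq> j" using E_lt[of i j] by auto
    show "j \<in> NF i"
    proof (cases "j \<in> S")
      case False
      then have "j \<in> R" using j jn by (auto simp: W_def)
      then show ?thesis using edge that j jn by (auto simp: NF_def F_def join_plus_def)
    qed (use jn in \<open>auto simp: NF_def F_def join_plus_def\<close>)
  qed
  have rowW: "S \<subseteq> NF i" if "i \<in> W" for i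
    using that S_subset disjoint_SRW(2) W_subset by (auto simp: NF_def F_def join_plus_def)
  let ?ER = "\<lambda>i. \<Sum>j\<in>N i \<inter> W. x j"
  \<comment> \<open>What the candidate gains in the rows of \<open>S\<close> is discarded: a missing
    edge between \<open>S\<close> and \<open>W\<close> is credited only in the row of its end in
    \<open>W\<close>.\<close>
  have rS: "l * x i \<le> (\<Sum>j\<in>NF i. x j)" if "i \<in> S" for i
    using eig[of i] that S_subset sum_mono2[OF finNF rowS[OF that], of x] x_nonneg by auto
  have rR: "l * x i \<le> (\<Sum>j\<in>NF i. x j) + ?ER i" if "i \<in> R" for i
  proof -
    have "(\<Sum>j\<in>N i. x j) = ?ER i + (\<Sum>j\<in>N i - W. x j)" by (simp add: sum.Int_Diff[of "N i" x W])
    moreover have "(\<Sum>j\<in>N i - W. x j) \<le> (\<Sum>j\<in>NF i. x j)"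
      by (intro sum_mono2 finNF rowR[OF that] x_nonneg)
    ultimately show ?thesis using eig[of i] that R_subset by auto
  qed
  \<comment> \<open>A vertex of \<open>W\<close> is not adjacent to some \<open>w\<close> in
    \<open>S\<close>, and \<open>x w\<close> is at least 1/2: this is the source of the gain
    \<open>s / 2\<close>.\<close>
  have rW: "l * x i \<le> (\<Sum>j\<in>NF i. x j) - 1 / 2 + (\<Sum>j\<in>N i \<inter> R. x j) + ?ER i" if "i \<in> W" for i
  proof -
    have "i \<notin> R" "i < n" using that by (auto simp: W_def)
    then obtain w where w: "w \<in> S" "\<not> E w i" by (auto simp: R_def)
    have "(\<Sum>j\<in>N i \<inter> S. x j) \<le> (\<Sum>j\<in>S - {w}. x j)"
      using w E_sym[of w i] by (intro sum_mono2 x_nonneg) auto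
    also have "\<dots> = (\<Sum>j\<in>S. x j) - x w" using w(1) by (simp add: sum_diff1)
    also have "\<dots> \<le> (\<Sum>j\<in>S. x j) - 1 / 2" using half[OF w(1)] by simp
    also have "(\<Sum>j\<in>S. x j) \<le> (\<Sum>j\<in>NF i. x j)" by (intro sum_mono2 finNF rowW[OF that] x_nonneg)
    finally show ?thesis using eig[OF \<open>i < n\<close>] sum_N_SRW[of x i] by simp
  qed
  have splitV: "(\<Sum>i<n. f i) = (\<Sum>i\<in>S. f i) + (\<Sum>i\<in>R. f i) + (\<Sum>i\<in>W. f i)" for f :: "nat \<Rightarrow> real"
  proof -
    have "(\<Sum>i<n. f i) = (\<Sum>i\<in>S \<union> R. f i) + (\<Sum>i\<in>W. f i)"
      unfolding vertices_SRW using disjoint_SRW by (intro sum.union_disjoint) auto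
    also have "(\<Sum>i\<in>S \<union> R. f i) = (\<Sum>i\<in>S. f i) + (\<Sum>i\<in>R. f i)"
      using disjoint_SRW by (intro sum.union_disjoint) auto
    finally show ?thesis .
  qed
  have WR: "(\<Sum>i\<in>R. x i * ?ER i) = quadWR"
  proof -
    have "(\<Sum>i\<in>R. x i * ?ER i) = (\<Sum>i\<in>R. \<Sum>j\<in>N i \<inter> W. x i * x j)" by (simp add: sum_distrib_left)
    also have "\<dots> = (\<Sum>j\<in>W. \<Sum>i\<in>N j \<inter> R. x i * x j)" by (rule sum_N_swap) auto
    finally show ?thesis by (simp add: sum_distrib_left mult.commute)
  qed
  have sq: "l * sqnorm n x = (\<Sum>i<n. x i * (l * x i))"
    by (simp add: sqnorm_def sum_distrib_left power2_eq_square mult_ac)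
  also have "\<dots> \<le> (\<Sum>i\<in>S. x i * (\<Sum>j\<in>NF i. x j)) + (\<Sum>i\<in>R. x i * ((\<Sum>j\<in>NF i. x j) + ?ER i))
      + (\<Sum>i\<in>W. x i * ((\<Sum>j\<in>NF i. x j) - 1 / 2 + (\<Sum>j\<in>N i \<inter> R. x j) + ?ER i))"
    unfolding splitV by (intro add_mono sum_mono mult_left_mono rS rR rW x_nonneg)
  also have "\<dots> = quad n F x + (\<Sum>i\<in>R. x i * ?ER i) + quadWR + quadW - s / 2"
    unfolding quadF splitV
    by (simp add: distrib_left right_diff_distrib sum.distrib sum_subtractf sum_divide_distrib)
  finally have main: "l * sqnorm n x \<le> quad n F x + (2 * quadWR + quadW) - s / 2" using WR by simp
  have Fle: "quad n F x \<le> ?lF * sqnorm n x" by (rule quad_le_spectral_radius[OF F_graph n1])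
  have lFl: "?lF * sqnorm n x \<le> l * sqnorm n x" using lF by (rule mult_right_mono) simp
  \<comment> \<open>The form of the candidate exceeds \<open>l * sqnorm n x\<close> by at least
    \<open>s / 4\<close>, yet is at most that value because \<open>?lF \<le> l\<close>. So
    \<open>s\<close> is 0 and every inequality in the chain is an equality.\<close>
  have "s = 0" using main Fle lFl small s_nonneg by linarith
  then have xW: "x w = 0" if "w \<in> W" for w
    using that sum_nonneg_eq_0_iff[of W x] x_nonneg by simp
  have Feq: "quad n F x = ?lF * sqnorm n x" "?lF * sqnorm n x = l * sqnorm n x"
    using main Fle lFl small \<open>s = 0\<close> by linarith+
  have "sqnorm n x > 0" by (rule sqnorm_pos[OF z_lt]) (simp add: x_z)
  then have lFeq: "?lF = l" using Feq(2) by simp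
  have eigF: "(\<Sum>j\<in>NF i. x j) = l * x i" if "i < n" for i
    using rayleigh_maximizer_is_eigenvector[OF F_graph that quad_le_spectral_radius[OF F_graph n1] Feq(1)]
    by (simp add: AF lFeq)
  \<comment> \<open>\<open>x\<close> is now also an eigenvector of the candidate, in which every
    vertex outside \<open>S\<close> is adjacent to all of \<open>S\<close>, where entries are at
    least 1/2.\<close>
  have pos: "0 < x i" if i: "i < n" for i
  proof (cases "i \<in> S")
    case True
    then show ?thesis using half[OF True] by simp
  next
    case False
    obtain w where w: "w \<in> S" using S_nonempty by blast
    have "w \<in> NF i" using w False i S_subset by (auto simp: NF_def F_def join_plus_def)
    then have "x w \<le> (\<Sum>j\<in>NF i. x j)" by (intro member_le_sum finNF x_nonneg)
    then have "0 < l * x i" using eigF[OF i] half[OF w] by simp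
    then show ?thesis using l_pos by (simp add: zero_less_mult_iff)
  qed
  have "W = {}" using xW pos W_subset by fastforce
  have NFN: "NF i = N i" if i: "i < n" for i
  proof -
    have "i \<in> S \<or> i \<in> R" using i vertices_SRW \<open>W = {}\<close> by auto
    then have sub: "N i \<subseteq> NF i" using rowS[of i] rowR[of i] \<open>W = {}\<close> by auto
    \<comment> \<open>Both graphs have the same row sums at the positive vector \<open>x\<close>, so
      an additional neighbour in the candidate is impossible.\<close>
    have "(\<Sum>j\<in>NF i. x j) = (\<Sum>j\<in>N i. x j) + (\<Sum>j\<in>NF i - N i. x j)"
      using sum.subset_diff[OF sub finNF, of x] by simp
    then have "(\<Sum>j\<in>NF i - N i. x j) = 0" using eigF[OF i] eig[OF i] by simp
    then have "\<forall>j\<in>NF i - N i. x j = 0"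
      using sum_nonneg_eq_0_iff[of "NF i - N i" x] x_nonneg finNF by simp
    then have "NF i - N i = {}" using pos by (fastforce simp: NF_def)
    then show ?thesis using sub by blast
  qed
  have "E i j \<longleftrightarrow> F i j" for i j
  proof (cases "i < n \<and> j < n")
    case True
    then have "j \<in> N i \<longleftrightarrow> j \<in> NF i" using NFN[of i] by simp
    then show ?thesis using True by (simp add: NF_def)
  next
    case False
    then show ?thesis using E_lt[of i j] F_graph by (auto simp: is_graph_def)
  qed
  then have "E = F" by blast
  then show ?thesis using iso by simp
qed

end

lemma extremal_graph_unique:
  assumes "k \<ge> 2"
  shows "\<forall>\<^sub>F n in sequentially. \<forall>E. is_graph n E \<longrightarrow> \<not> contains_cycle n E (2 * k + 2) \<longrightarrow>
    spectral_radius n (S_plus n k) \<le> spectral_radius n E \<longrightarrow> graph_iso n E (S_plus n k)"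
proof -
  \<comment> \<open>The three terms 2/l, 4d and 2 th will add up to at most 5 th, and (k + 1) * 5 th
    = 5/24 stays below 1/4.\<close>
  define th where "th = 1 / (24 * (real k + 1))"
  have th: "0 < th" "th \<le> 1 / 2" "(real k + 1) * th = 1 / 24" by (simp_all add: th_def field_simps)
  \<comment> \<open>As \<open>card W\<close> is at most \<open>d * n\<close> and \<open>n\<close> is
    at most the squared spectral radius, this \<open>d\<close> makes the square root in
    \<open>quad_W_le\<close> at most \<open>th\<close> times the spectral radius.\<close>
  define d where "d = th\<^sup>2 / (4 * k + 5)"
  have d: "0 < d" "d * (4 * k + 5) = th\<^sup>2" using th by (simp_all add: d_def)
  have "d \<le> th\<^sup>2 / 5" unfolding d_def by (intro divide_left_mono) auto
  moreover have "th\<^sup>2 \<le> th * (1 / 2)" unfolding power2_eq_square using th by (intro mult_left_mono) auto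
  ultimately have dth: "d \<le> th / 4" "d < 1" using th by linarith+
  have e1: "\<forall>\<^sub>F n in sequentially. 1 / th \<le> sqrt (real n)" by (rule eventually_sqrt_ge)
  have e2: "\<forall>\<^sub>F n in sequentially. real (2 * k + 4) / (1 - d) + real (2 * k) + 1 \<le> real n" by (rule eventually_real_ge)
  from dominating_set_exists[OF d(1) dth(2), of k] e1 e2 show ?thesis
  proof eventually_elim
    case (elim n)
    have pos: "0 \<le> real (2 * k + 4) / (1 - d)" using dth by simp
    then have "real (2 * k) + 1 \<le> real n" using elim(3) by linarith
    then have n: "2 * k < n" by linarith
    have n2: "real (2 * k + 4) \<le> (1 - d) * n"
    proof -
      have "real (2 * k + 4) / (1 - d) \<le> real n" using elim(3) by linarith
      then show ?thesis using dth by (simp add: field_simps)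
    qed
    show ?case
    proof (intro allI impI)
      fix E assume E: "is_graph n E" "\<not> contains_cycle n E (2 * k + 2)"
        and sr: "spectral_radius n (S_plus n k) \<le> spectral_radius n E"
      interpret cycle_free n k E using E assms by unfold_locales
      let ?l = "spectral_radius n E"
      have n1: "n \<ge> 1" using n by simp
      obtain x z where xz: "z < n" "x z = 1" "\<forall>i. 0 \<le> x i \<and> x i \<le> 1"
          "\<forall>i<n. adj_mult n E x i = ?l * x i"
        by (rule perron_vector[OF E(1) n1])
      have Sp: "real k * (real n - real k) \<le> (spectral_radius n (S_plus n k))\<^sup>2"
          "0 \<le> spectral_radius n (S_plus n k)"
        using S_plus_spectral_radius[of k n] assms n by auto
      have lsq: "real k * (real n - real k) \<le> ?l\<^sup>2"
        using Sp(1) power_mono[OF sr Sp(2), of 2] by linarith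
      have eigs: "(\<Sum>j\<in>N i. x j) = ?l * x i" if "i < n" for i
      proof -
        have "{j. j < n \<and> E i j} = N i" using E_lt by auto
        then have "adj_mult n E x i = (\<Sum>j\<in>N i. x j)" by (simp only: adj_mult_eq_sum)
        then show ?thesis using xz(4) that by simp
      qed
      interpret perron n k E x ?l z
        using xz eigs lsq Sp(2) sr by unfold_locales auto
      obtain S where S: "S \<subseteq> {..<n}" "card S = k" "\<forall>w\<in>S. 1 / 2 \<le> x w"
          "(1 - d) * n \<le> card {u. \<forall>w\<in>S. E w u}"
        using elim(1) perron_axioms by blast
      have sl: "sqrt n \<le> ?l" "real n \<le> ?l\<^sup>2" using l_ge_sqrt n by auto
      have lth: "1 / th \<le> ?l" using elim(2) sl(1) by simp
      then have lpos: "0 < ?l" using th(1) by (smt (verit) divide_pos_pos)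
      have "real (2 * k + 4) \<le> real (card {u. \<forall>w\<in>S. E w u})" using n2 S(4) by linarith
      then have "2 * k + 4 \<le> card {u. \<forall>w\<in>S. E w u}" by (simp only: of_nat_le_iff)
      then interpret dominated_perron n k E x ?l z S
        using S lpos by unfold_locales auto
      have "card W \<le> card ({..<n} - R)" by (intro card_mono) (auto simp: W_def)
      also have "\<dots> = n - card R" using R_subset by (simp add: card_Diff_subset)
      finally have "real (card W) \<le> real n - real (card R)"
        using card_mono[OF _ R_subset] by simp
      also have "\<dots> \<le> d * n" using S(4) by (simp add: R_def algebra_simps)
      also have "\<dots> \<le> d * ?l\<^sup>2" using sl(2) d(1) by (intro mult_left_mono) auto
      finally have cW: "real (card W) \<le> d * ?l\<^sup>2" .
      have "sqrt ((4 * k + 5) * card W) \<le> sqrt (th\<^sup>2 * ?l\<^sup>2)"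
      proof -
        have "(4 * real k + 5) * card W \<le> (4 * real k + 5) * (d * ?l\<^sup>2)" using cW by (intro mult_left_mono) auto
        also have "\<dots> = (d * (4 * k + 5)) * ?l\<^sup>2" by (simp add: mult_ac)
        also have "\<dots> = th\<^sup>2 * ?l\<^sup>2" by (simp only: d(2))
        finally show ?thesis by simp
      qed
      also have "\<dots> = th * ?l" using th(1) lpos by (simp add: real_sqrt_mult)
      finally have sW: "sqrt ((4 * k + 5) * card W) \<le> th * ?l" .
      have "1 / ?l \<le> th" using lth th(1) lpos by (simp add: field_simps)
      then have "2 / ?l + 4 * d + 2 * th \<le> 5 * th" using dth(1) by simp
      then have "(real k + 1) * (2 / ?l + 4 * d + 2 * th) \<le> (real k + 1) * (5 * th)"
        by (intro mult_left_mono) auto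
      also have "\<dots> = 5 * ((real k + 1) * th)" by simp
      finally have "(real k + 1) * (2 / ?l + 4 * d + 2 * th) \<le> 5 * (1 / 24)" unfolding th(3) .
      then have sm: "(real k + 1) * (2 / ?l + 4 * d + 2 * th) \<le> 1 / 4" by linarith
      have "2 * quadWR + quadW \<le> s / 4"
        by (rule outside_weight_small[OF _ th(2) sW cW sm]) (use th in simp)
      then show "graph_iso n E (S_plus n k)" using sr by (rule iso_S_plus)
    qed
  qed
qed

theorem theorem1:
  fixes k :: nat
  assumes "k \<ge> 2"
  shows "\<exists>n0. \<forall>n\<ge>n0. \<forall>E. E \<in> SPEX n (2 * k + 2) \<longleftrightarrow> is_graph n E \<and> graph_iso n E (S_plus n k)"
proof -
  obtain n0 where n0: "\<And>n E. n \<ge> n0 \<Longrightarrow> is_graph n E \<Longrightarrow> \<not> contains_cycle n E (2 * k + 2) \<Longrightarrow>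
      spectral_radius n (S_plus n k) \<le> spectral_radius n E \<Longrightarrow> graph_iso n E (S_plus n k)"
    using extremal_graph_unique[OF assms] unfolding eventually_sequentially by blast
  show ?thesis
    by (intro exI[of _ n0] allI impI SPEX_eq_iso_class[OF assms] n0)
qed

end
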